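(* Let $d\ge2$ and let $H^2(\mathcal{B})$ be the polyharmonic Hardy space on the unit ball $\mathcal{B}$ of the Klein-Dirac quadric (defined in the context). Then: 1. The space $H^2(\mathcal{B})$ is complete. 2. $H^2(\mathcal{B})$ coincides with the space of functions $f$ having a representation $$f(z,\theta)=\sum_{k=0}^{\infty}\sum_{\ell=1}^{a_k}\sum_{j=0}^{\infty}f_{k,\ell;j}\,z^{k+2j}Y_{k,\ell}(\theta),\qquad |z|<1,\ \theta\in\mathbb{S}^{d-1},$$ with complex coefficients satisfying $$\sum_{k=0}^{\infty}\sum_{\ell=1}^{a_k}\sum_{j=0}^{\infty}|f_{k,\ell;j}|^2<\infty.$$ 3. For $f\in H^2(\mathcal{B})$ with the representation of item 2, the norm is $$\|f\|_{H^2(\mathcal{B})}=\Big\{\sum_{k=0}^{\infty}\sum_{\ell=1}^{a_k}\sum_{j=0}^{\infty}|f_{k,\ell;j}|^2\Big\}^{1/2},$$ and, with $z=re^{i\varphi}$, $$\|f\|_{H^2(\mathcal{B})}^2=\sum_{k=0}^{\infty}\sum_{\ell=1}^{a_k}\lim_{r\to1^-}\frac1{2\pi}\int_0^{2\pi}\Big|z^k\sum_{j=0}^{\infty}f_{k,\ell;j}z^{2j}\Big|^2d\varphi=\sum_{k=0}^{\infty}\sum_{\ell=1}^{a_k}\sum_{j=0}^{\infty}|f_{k,\ell;j}|^2.$$ 4. Every $f\in H^2(\mathcal{B})$ is the limit in $H^2(\mathcal{B})$ of a sequence of polynomials $P_N$ (identified with their $r$-complexifications $P_N(z\theta)$) which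 satisfy $\Delta^NP_N(x)=0$ for $x\in B$.
   Context: $\mathbb{D}=\{z\in\mathbb{C}:|z|<1\}$; $B=\{x\in\mathbb{R}^d:|x|<1\}$; $\mathbb{S}^{d-1}$ is the unit sphere of $\mathbb{R}^d$ with rotation-invariant measure $d\theta$. $\mathcal{H}_k(\mathbb{R}^d)$ is the space of harmonic homogeneous complex-valued polynomials of degree $k$, $a_k=\dim\mathcal{H}_k(\mathbb{R}^d)$, and $Y_{k,\ell}$ ($\ell=1,\dots,a_k$) is a fixed basis of $\mathcal{H}_k(\mathbb{R}^d)$ orthonormal for $\int_{\mathbb{S}^{d-1}}f\overline g\,d\theta$. The unit ball of the Klein-Dirac quadric is $\mathcal{B}=\{z\theta: z\in\mathbb{D},\theta\in\mathbb{S}^{d-1}\}=\mathbb{D}\times\mathbb{S}^{d-1}/\mathbb{Z}_2$, where $(z,\theta)$ and $(-z,-\theta)$ are identified. $H^2(\mathbb{D})$ is the classical Hardy space of analytic functions $g$ on $\mathbb{D}$ with $\|g\|^2_{H^2(\mathbb{D})}=\sup_{r<1}\frac1{2\pi}\int_0^{2\pi}|g(re^{i\varphi})|^2d\varphi<\infty$, and $H^{2,k}(\mathbb{D})=\{g: g(z)=g_1(z^2)z^k,\ g_1\in H^2(\mathbb{D})\}$ with the norm of $H^2(\mathbb{D})$. The polyharmonic Hardy space $H^2(\mathcal{B})$ is the space of functions $f(z,\theta)=\sum_{k=0}^{\infty}\sum_{\ell=1}^{a_k}f_{k,\ell}(z)Y_{k,\ell}(\theta)$ with $f_{k,\ell}\in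 H^{2,k}(\mathbb{D})$ and $$\|f\|_{H^2(\mathcal{B})}:=\Big(\sum_{k=0}^{\infty}\sum_{\ell=1}^{a_k}\|f_{k,\ell}\|_{H^2(\mathbb{D})}^2\Big)^{1/2}<\infty.$$ The $r$-complexification of a polynomial $P(r\theta)=\sum_{k,\ell,j}c_{k,\ell,j}r^{k+2j}Y_{k,\ell}(\theta)$ (finite sum) is $P(z\theta)=\sum_{k,\ell,j}c_{k,\ell,j}z^{k+2j}Y_{k,\ell}(\theta)$. *)

theory Defs
  imports "HOL-Analysis.Analysis" "HOL-Library.Function_Algebras"
begin

section \<open>Spherical harmonics\<close>

interpretation cfun: vector_space "\<lambda>(c::complex) (f::'a \<Rightarrow> complex) x. c * f x"
  by unfold_locales (auto simp: fun_eq_iff algebra_simps)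

text \<open>The normalisation of the measure on the sphere is left open: up to a positive factor
  there is exactly one measure with these properties.\<close>

definition rotation_invariant_sphere_measure :: "(real^'n) measure \<Rightarrow> bool" where
  "rotation_invariant_sphere_measure \<sigma> \<longleftrightarrow>
     sets \<sigma> = sets (restrict_space borel (sphere 0 1)) \<and>
     finite_measure \<sigma> \<and> emeasure \<sigma> (space \<sigma>) \<noteq> 0 \<and>
     (\<forall>A. rotation_matrix A \<longrightarrow> distr \<sigma> \<sigma> ((*v) A) = \<sigma>)"

definition partial_deriv :: "'n \<Rightarrow> (real^'n \<Rightarrow> complex) \<Rightarrow> real^'n \<Rightarrow> complex" where
  "partial_deriv i f x = vector_derivative (\<lambda>t. f (x + t *\<^sub>R axis i 1)) (at 0)"

definition laplacian :: "(real^'n \<Rightarrow> complex) \<Rightarrow> real^'n \<Rightarrow> complex" where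
  "laplacian f x = (\<Sum>i\<in>UNIV. partial_deriv i (partial_deriv i f) x)"

definition harmonics :: "nat \<Rightarrow> (real^'n \<Rightarrow> complex) set" where
  "harmonics k = {p. polynomial_function p \<and>
     (\<forall>t x. p (t *\<^sub>R x) = of_real t ^ k * p x) \<and> (\<forall>x. laplacian p x = 0)}"

definition harmonic_dim :: "'n::finite itself \<Rightarrow> nat \<Rightarrow> nat" where
  "harmonic_dim _ k = cfun.dim (harmonics k :: (real^'n \<Rightarrow> complex) set)"

definition spherical_harmonic_basis ::
    "(real^'n) measure \<Rightarrow> (nat \<Rightarrow> nat \<Rightarrow> real^'n \<Rightarrow> complex) \<Rightarrow> bool" where
  "spherical_harmonic_basis \<sigma> Y \<longleftrightarrow>
     (\<forall>k. Y k ` {1..harmonic_dim TYPE('n) k} \<subseteq> harmonics k \<and>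
          cfun.span (Y k ` {1..harmonic_dim TYPE('n) k}) = harmonics k \<and>
          (\<forall>l\<in>{1..harmonic_dim TYPE('n) k}. \<forall>m\<in>{1..harmonic_dim TYPE('n) k}.
             (LINT \<theta>|\<sigma>. Y k l \<theta> * cnj (Y k m \<theta>)) = (if l = m then 1 else 0)))"


section \<open>Hardy spaces on the disc\<close>

definition circle_mean :: "(complex \<Rightarrow> complex) \<Rightarrow> real \<Rightarrow> real" where
  "circle_mean g r =
     1 / (2 * pi) * integral {0..2 * pi} (\<lambda>\<phi>. (cmod (g (of_real r * cis \<phi>)))\<^sup>2)"

definition hardy :: "(complex \<Rightarrow> complex) set" where
  "hardy = {g. g holomorphic_on ball 0 1 \<and> bdd_above (circle_mean g ` {0..<1})}"

definition hardy_norm :: "(complex \<Rightarrow> complex) \<Rightarrow> real" where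
  "hardy_norm g = sqrt (SUP r\<in>{0..<1}. circle_mean g r)"

definition hardy_parity :: "nat \<Rightarrow> (complex \<Rightarrow> complex) set" where
  "hardy_parity k = {g. \<exists>g1\<in>hardy. \<forall>z\<in>ball 0 1. g z = g1 (z\<^sup>2) * z ^ k}"


section \<open>The polyharmonic Hardy space\<close>

definition kd_point :: "complex \<Rightarrow> real^'n \<Rightarrow> complex^'n" where
  "kd_point z \<theta> = (\<chi> i. z * of_real (\<theta> $ i))"

text \<open>The points given by \<open>(z, \<theta>)\<close> and \<open>(-z, -\<theta>)\<close> coincide; all \<open>(0, \<theta>)\<close> give the origin.
  The latter is harmless because the functions considered below do not depend on \<open>\<theta>\<close>
  at \<open>z = 0\<close>.\<close>

definition kd_ball :: "(complex^'n) set" where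
  "kd_ball = {kd_point z \<theta> | z \<theta>. z \<in> ball 0 1 \<and> \<theta> \<in> sphere 0 1}"

text \<open>Functions on the ball are represented by functions vanishing off the ball, so that
  equality of functions is equality on the ball.\<close>

definition kd_functions :: "(complex^'n \<Rightarrow> complex) set" where
  "kd_functions = {f. \<forall>x. x \<notin> kd_ball \<longrightarrow> f x = 0}"

definition hardy_expansion ::
    "(nat \<Rightarrow> nat \<Rightarrow> real^'n \<Rightarrow> complex) \<Rightarrow> (nat \<Rightarrow> nat \<Rightarrow> complex \<Rightarrow> complex) \<Rightarrow>
     (complex^'n \<Rightarrow> complex) \<Rightarrow> bool" where
  "hardy_expansion Y F f \<longleftrightarrow>
     (\<forall>k. \<forall>l\<in>{1..harmonic_dim TYPE('n) k}. F k l \<in> hardy_parity k) \<and>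
     summable (\<lambda>k. \<Sum>l = 1..harmonic_dim TYPE('n) k. (hardy_norm (F k l))\<^sup>2) \<and>
     (\<forall>z\<in>ball 0 1. \<forall>\<theta>\<in>sphere 0 1.
        (\<lambda>k. \<Sum>l = 1..harmonic_dim TYPE('n) k. F k l z * Y k l \<theta>) sums f (kd_point z \<theta>))"

definition poly_hardy ::
    "(nat \<Rightarrow> nat \<Rightarrow> real^'n \<Rightarrow> complex) \<Rightarrow> (complex^'n \<Rightarrow> complex) set" where
  "poly_hardy Y = {f \<in> kd_functions. \<exists>F. hardy_expansion Y F f}"

text \<open>The component functions of an element of the space are unique on the disc, so the choice
  below does not affect the norm. The sum over \<open>k\<close> is an \<open>infsum\<close> only
  to make the value nonnegative for functions outside the space as well, as \<open>Metric_space\<close>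
  asks of a distance; on the space itself it is the usual sum of the series.\<close>

definition poly_hardy_norm ::
    "(nat \<Rightarrow> nat \<Rightarrow> real^'n \<Rightarrow> complex) \<Rightarrow> (complex^'n \<Rightarrow> complex) \<Rightarrow> real" where
  "poly_hardy_norm Y f =
     (let F = SOME F. hardy_expansion Y F f
      in sqrt (\<Sum>\<^sub>\<infinity>k. \<Sum>l = 1..harmonic_dim TYPE('n) k. (hardy_norm (F k l))\<^sup>2))"

definition poly_hardy_dist ::
    "(nat \<Rightarrow> nat \<Rightarrow> real^'n \<Rightarrow> complex) \<Rightarrow>
     (complex^'n \<Rightarrow> complex) \<Rightarrow> (complex^'n \<Rightarrow> complex) \<Rightarrow> real" where
  "poly_hardy_dist Y f g = poly_hardy_norm Y (f - g)"


section \<open>Power series representations and complexification\<close>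

definition square_summable_coeffs ::
    "'n::finite itself \<Rightarrow> (nat \<Rightarrow> nat \<Rightarrow> nat \<Rightarrow> complex) \<Rightarrow> bool" where
  "square_summable_coeffs T c \<longleftrightarrow>
     (\<forall>k. \<forall>l\<in>{1..harmonic_dim T k}. summable (\<lambda>j. (cmod (c k l j))\<^sup>2)) \<and>
     summable (\<lambda>k. \<Sum>l = 1..harmonic_dim T k. \<Sum>j. (cmod (c k l j))\<^sup>2)"

definition power_expansion ::
    "(nat \<Rightarrow> nat \<Rightarrow> real^'n \<Rightarrow> complex) \<Rightarrow> (nat \<Rightarrow> nat \<Rightarrow> nat \<Rightarrow> complex) \<Rightarrow>
     (complex^'n \<Rightarrow> complex) \<Rightarrow> bool" where
  "power_expansion Y c f \<longleftrightarrow>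
     (\<forall>z\<in>ball 0 1. \<forall>\<theta>\<in>sphere 0 1.
        (\<forall>k. \<forall>l\<in>{1..harmonic_dim TYPE('n) k}.
           summable (\<lambda>j. c k l j * z ^ (k + 2 * j) * Y k l \<theta>)) \<and>
        (\<lambda>k. \<Sum>l = 1..harmonic_dim TYPE('n) k. \<Sum>j. c k l j * z ^ (k + 2 * j) * Y k l \<theta>)
          sums f (kd_point z \<theta>))"

text \<open>\<open>Q\<close> is the \<open>r\<close>-complexification of \<open>P\<close>, as a function on the ball.\<close>

definition r_complexification ::
    "(nat \<Rightarrow> nat \<Rightarrow> real^'n \<Rightarrow> complex) \<Rightarrow> (real^'n \<Rightarrow> complex) \<Rightarrow>
     (complex^'n \<Rightarrow> complex) \<Rightarrow> bool" where
  "r_complexification Y P Q \<longleftrightarrow>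
     Q \<in> kd_functions \<and>
     (\<exists>c I. finite I \<and> I \<subseteq> {(k, l, j). l \<in> {1..harmonic_dim TYPE('n) k}} \<and>
        (\<forall>r\<ge>0. \<forall>\<theta>\<in>sphere 0 1.
           P (r *\<^sub>R \<theta>) = (\<Sum>(k, l, j)\<in>I. c k l j * of_real r ^ (k + 2 * j) * Y k l \<theta>)) \<and>
        (\<forall>z\<in>ball 0 1. \<forall>\<theta>\<in>sphere 0 1.
           Q (kd_point z \<theta>) = (\<Sum>(k, l, j)\<in>I. c k l j * z ^ (k + 2 * j) * Y k l \<theta>)))"

end

theory Submission
  imports Defs "HOL-Complex_Analysis.Cauchy_Integral_Formula"
begin

text \<open>By Parseval's identity on circles, a function in \<open>H\<^sup>2\<^sup>,\<^sup>k(\<D>)\<close> is a power series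
  \<open>\<Sum>\<^sub>j c\<^sub>j z\<^bsup>k+2j\<^esup>\<close> with square summable coefficients, and its norm is the
  \<open>\<ell>\<^sup>2\<close> norm of the coefficients. So the polyharmonic Hardy space is \<open>\<ell>\<^sup>2\<close> over the index
  triples \<open>(k, \<ell>, j)\<close>, once two points are settled.

  Every square summable family must define a function. The sum \<open>\<Sum>\<^sub>\<ell> |Y\<^sub>k\<^sub>\<ell>(\<theta>)|\<^sup>2\<close> is rotation
  invariant, hence constant on the sphere, hence proportional to \<open>dim \<H>\<^sub>k\<close>, which grows polynomially
  in \<open>k\<close>; so the series converges absolutely for \<open>|z| < 1\<close> by the Cauchy-Schwarz inequality.

  The coefficients must be unique. If the series vanishes identically, then comparing powers of \<open>z\<close>
  gives \<open>\<Sum>\<^sub>j h\<^sub>j(\<theta>) = 0\<close> on the sphere with \<open>h\<^sub>j\<close> harmonic of degree \<open>m - 2j\<close>, that is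
  \<open>\<Sum>\<^sub>j |x|\<^bsup>2j\<^esup> h\<^sub>j(x) = 0\<close>. Since \<open>\<Delta>\<close> maps \<open>|x|\<^bsup>2j\<^esup> h\<close> to a positive multiple of
  \<open>|x|\<^bsup>2j-2\<^esup> h\<close>, applying the highest relevant power of \<open>\<Delta>\<close> kills all but one term. The same
  identity shows that the truncations \<open>k, j < N\<close> are annihilated by \<open>\<Delta>\<^sup>N\<close>.\<close>

section \<open>Polynomial functions and the Laplacian\<close>

lemma polynomial_function_complex_iff:
  fixes p :: "'a::euclidean_space \<Rightarrow> complex"
  shows "polynomial_function p \<longleftrightarrow>
    real_polynomial_function (\<lambda>x. Re (p x)) \<and> real_polynomial_function (\<lambda>x. Im (p x))"
  by (auto simp: polynomial_function_iff_Basis_inner Basis_complex_def)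

lemma polynomial_function_times:
  fixes p q :: "'a::euclidean_space \<Rightarrow> complex"
  assumes "polynomial_function p" "polynomial_function q"
  shows "polynomial_function (\<lambda>x. p x * q x)"
  using assms
  by (auto simp: polynomial_function_complex_iff
      intro!: real_polynomial_function_diff real_polynomial_function.intros(3,4))

lemma polynomial_function_of_real:
  fixes p :: "'a::euclidean_space \<Rightarrow> real"
  assumes "real_polynomial_function p"
  shows "polynomial_function (\<lambda>x. complex_of_real (p x))"
  using assms by (auto simp: polynomial_function_complex_iff)

lemma polynomial_function_sum_times:
  fixes p :: "'i \<Rightarrow> 'a::euclidean_space \<Rightarrow> complex"
  assumes "finite I" "\<And>i. i \<in> I \<Longrightarrow> polynomial_function (p i)"
  shows "polynomial_function (\<lambda>x. \<Sum>i\<in>I. c i * p i x)"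
  using assms by (intro polynomial_function_sum polynomial_function_times polynomial_function_const) auto

lemma polynomial_function_linear_compose:
  fixes p :: "'a::euclidean_space \<Rightarrow> complex"
  assumes "polynomial_function p" "linear (f :: 'b::euclidean_space \<Rightarrow> 'a)"
  shows "polynomial_function (\<lambda>x. p (f x))"
  using polynomial_function_compose[OF polynomial_function_bounded_linear assms(1), of f] assms(2)
  by (simp add: o_def linear_conv_bounded_linear)

text \<open>Induction over the construction of real polynomials; complex ones are reduced to this
  through real and imaginary parts. That the derivative is again polynomial is what allows
  differentiation to be iterated.\<close>

lemma real_polynomial_directional_derivative:
  assumes "real_polynomial_function p"
  shows "\<exists>q. real_polynomial_function q \<and>
    (\<forall>x. ((\<lambda>t. p (x + t *\<^sub>R v)) has_real_derivative q x) (at 0))"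
  using assms
proof induction
  case (linear f)
  have "((\<lambda>t. f (x + t *\<^sub>R v)) has_real_derivative f v) (at 0)" for x
  proof -
    have "(\<lambda>t. f (x + t *\<^sub>R v)) = (\<lambda>t. f x + t * f v)"
      using linear by (auto simp: linear_simps)
    then show ?thesis by (auto intro!: derivative_eq_intros)
  qed
  then show ?case by blast
next
  case (const c)
  then show ?case by (auto intro!: exI[of _ "\<lambda>_. 0"])
next
  case (add f g)
  then obtain f' g' where "real_polynomial_function f'" "real_polynomial_function g'"
    "\<And>x. ((\<lambda>t. f (x + t *\<^sub>R v)) has_real_derivative f' x) (at 0)"
    "\<And>x. ((\<lambda>t. g (x + t *\<^sub>R v)) has_real_derivative g' x) (at 0)" by blast
  then show ?case
    by (intro exI[of _ "\<lambda>x. f' x + g' x"]) (auto intro!: DERIV_add)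
next
  case (mult f g)
  then obtain f' g' where "real_polynomial_function f'" "real_polynomial_function g'"
    and D: "\<And>x. ((\<lambda>t. f (x + t *\<^sub>R v)) has_real_derivative f' x) (at 0)"
    "\<And>x. ((\<lambda>t. g (x + t *\<^sub>R v)) has_real_derivative g' x) (at 0)" by blast
  moreover have "((\<lambda>t. f (x + t *\<^sub>R v) * g (x + t *\<^sub>R v)) has_real_derivative f' x * g x + g' x * f x) (at 0)" for x
    using DERIV_mult[OF D(1)[of x] D(2)[of x]] by simp
  ultimately show ?case using mult
    by (intro exI[of _ "\<lambda>x. f' x * g x + g' x * f x"]) auto
qed

lemma polynomial_function_partial_deriv:
  fixes p :: "real^'n \<Rightarrow> complex"
  assumes "polynomial_function p"
  shows "polynomial_function (partial_deriv i p)"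
proof -
  obtain a where a: "real_polynomial_function a"
    "\<And>x. ((\<lambda>t. Re (p (x + t *\<^sub>R axis i 1))) has_real_derivative a x) (at 0)"
    using real_polynomial_directional_derivative[of "\<lambda>x. Re (p x)" "axis i 1"] assms
    by (auto simp: polynomial_function_complex_iff)
  obtain b where b: "real_polynomial_function b"
    "\<And>x. ((\<lambda>t. Im (p (x + t *\<^sub>R axis i 1))) has_real_derivative b x) (at 0)"
    using real_polynomial_directional_derivative[of "\<lambda>x. Im (p x)" "axis i 1"] assms
    by (auto simp: polynomial_function_complex_iff)
  have D: "((\<lambda>t. p (x + t *\<^sub>R axis i 1)) has_vector_derivative Complex (a x) (b x)) (at 0)" for x
    using a(2)[of x] b(2)[of x]
    by (auto simp: has_vector_derivative_complex_iff)
  then have eq: "partial_deriv i p = (\<lambda>x. Complex (a x) (b x))"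
    by (auto simp: partial_deriv_def fun_eq_iff intro: vector_derivative_at)
  show "polynomial_function (partial_deriv i p)"
    using a b by (auto simp: polynomial_function_complex_iff eq)
qed

text \<open>Connects the one-dimensional definition of \<open>partial_deriv\<close> with the total
  derivative, so that the product, sum and chain rules for \<open>has_derivative\<close> carry
  over.\<close>

lemma partial_deriv_eqI:
  fixes p :: "real^'n \<Rightarrow> complex"
  assumes "(p has_derivative D) (at x)"
  shows "partial_deriv i p x = D (axis i 1)"
proof -
  have "((\<lambda>t. x + t *\<^sub>R axis i (1::real)) has_vector_derivative axis i 1) (at 0)"
    by (auto intro!: derivative_eq_intros simp: has_vector_derivative_def)
  moreover have "(p has_derivative D) (at (x + 0 *\<^sub>R axis i 1))"
    using assms by simp
  ultimately have "((p \<circ> (\<lambda>t. x + t *\<^sub>R axis i 1)) has_vector_derivative D (axis i 1)) (at 0)"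
    by (metis vector_derivative_diff_chain_within has_derivative_at_withinI)
  then show ?thesis
    by (simp add: partial_deriv_def o_def vector_derivative_at)
qed

lemma polynomial_has_derivative:
  fixes p :: "real^'n \<Rightarrow> complex"
  assumes "polynomial_function p"
  shows "(p has_derivative (\<lambda>v. \<Sum>i\<in>UNIV. (v $ i) *\<^sub>R partial_deriv i p x)) (at x)"
proof -
  obtain D where D: "(p has_derivative D) (at x)"
    using differentiable_at_polynomial_function[OF assms] by (auto simp: differentiable_def)
  then have "linear D" by (simp add: has_derivative_linear)
  then have "D v = (\<Sum>i\<in>UNIV. (v $ i) *\<^sub>R partial_deriv i p x)" for v
  proof -
    have "D v = D (\<Sum>i\<in>UNIV. v $ i *\<^sub>R axis i 1)"
      by (simp only: basis_expansion scalar_mult_eq_scaleR[symmetric])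
    also have "\<dots> = (\<Sum>i\<in>UNIV. v $ i *\<^sub>R D (axis i 1))"
      using \<open>linear D\<close> by (simp add: linear_sum linear_scale)
    finally show ?thesis by (simp add: partial_deriv_eqI[OF D])
  qed
  then have "D = (\<lambda>v. \<Sum>i\<in>UNIV. (v $ i) *\<^sub>R partial_deriv i p x)" by auto
  then show ?thesis using D by simp
qed

lemma partial_deriv_times:
  fixes p q :: "real^'n \<Rightarrow> complex"
  assumes "polynomial_function p" "polynomial_function q"
  shows "partial_deriv i (\<lambda>x. p x * q x) = (\<lambda>x. p x * partial_deriv i q x + partial_deriv i p x * q x)"
proof
  fix x
  show "partial_deriv i (\<lambda>x. p x * q x) x = p x * partial_deriv i q x + partial_deriv i p x * q x"
    using partial_deriv_eqI[OF has_derivative_mult[OF assms[THEN polynomial_has_derivative, of x]], of i]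
    by (simp add: axis_def if_distrib[of "\<lambda>u. u *\<^sub>R _"] cong: if_cong)
qed

lemma partial_deriv_sum:
  fixes p :: "'i \<Rightarrow> real^'n \<Rightarrow> complex"
  assumes "\<And>j. j \<in> J \<Longrightarrow> polynomial_function (p j)"
  shows "partial_deriv i (\<lambda>x. \<Sum>j\<in>J. c j * p j x) = (\<lambda>x. \<Sum>j\<in>J. c j * partial_deriv i (p j) x)"
proof
  fix x
  have "((\<lambda>x. \<Sum>j\<in>J. c j * p j x) has_derivative
      (\<lambda>v. \<Sum>j\<in>J. c j * (\<Sum>i\<in>UNIV. (v $ i) *\<^sub>R partial_deriv i (p j) x))) (at x)"
    using assms by (intro has_derivative_sum has_derivative_mult_right polynomial_has_derivative)
  from partial_deriv_eqI[OF this, of i]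
  show "partial_deriv i (\<lambda>x. \<Sum>j\<in>J. c j * p j x) x = (\<Sum>j\<in>J. c j * partial_deriv i (p j) x)"
    by (simp add: axis_def if_distrib[of "\<lambda>u. u *\<^sub>R _"] cong: if_cong)
qed

lemma laplacian_sum:
  fixes p :: "'i \<Rightarrow> real^'n \<Rightarrow> complex"
  assumes "\<And>j. j \<in> J \<Longrightarrow> polynomial_function (p j)"
  shows "laplacian (\<lambda>x. \<Sum>j\<in>J. c j * p j x) = (\<lambda>x. \<Sum>j\<in>J. c j * laplacian (p j) x)"
  using assms
  by (auto simp: laplacian_def fun_eq_iff partial_deriv_sum polynomial_function_partial_deriv
      sum_distrib_left intro: sum.swap)

lemma polynomial_function_laplacian:
  fixes p :: "real^'n \<Rightarrow> complex"
  assumes "polynomial_function p"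
  shows "polynomial_function (laplacian p)"
  unfolding laplacian_def[abs_def]
  using assms by (intro polynomial_function_sum polynomial_function_partial_deriv) auto

lemma laplacian_cmul:
  fixes p :: "real^'n \<Rightarrow> complex"
  assumes "polynomial_function p"
  shows "laplacian (\<lambda>x. c * p x) = (\<lambda>x. c * laplacian p x)"
  using laplacian_sum[of "{()}" "\<lambda>_. p" "\<lambda>_. c"] assms by simp

section \<open>The Laplacian on powers of |x|^2 times a harmonic\<close>

text \<open>Differentiate p(tx) = t^m p(x) at t = 1, once by the chain rule and once
  directly.\<close>

lemma euler_homogeneous:
  fixes p :: "real^'n \<Rightarrow> complex"
  assumes p: "polynomial_function p" and hom: "\<And>t x. p (t *\<^sub>R x) = of_real t ^ m * p x"
  shows "(\<Sum>i\<in>UNIV. of_real (x $ i) * partial_deriv i p x) = of_nat m * p x"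
proof -
  have "((\<lambda>t. t *\<^sub>R x) has_vector_derivative x) (at 1)"
    by (auto intro!: derivative_eq_intros simp: has_vector_derivative_def)
  moreover have "(p has_derivative (\<lambda>v. \<Sum>i\<in>UNIV. (v $ i) *\<^sub>R partial_deriv i p x)) (at (1 *\<^sub>R x))"
    using polynomial_has_derivative[OF p, of x] by simp
  ultimately have "((p \<circ> (\<lambda>t. t *\<^sub>R x)) has_vector_derivative (\<Sum>i\<in>UNIV. (x $ i) *\<^sub>R partial_deriv i p x)) (at 1)"
    by (rule vector_derivative_diff_chain_within[OF _ has_derivative_at_withinI])
  moreover have "((\<lambda>t. of_real t ^ m * p x) has_vector_derivative (of_nat m * p x)) (at (1::real))"
  proof -
    have "((\<lambda>t. t ^ m * p x) has_field_derivative (of_nat m * p x)) (at (of_real 1))"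
      by (auto intro!: derivative_eq_intros)
    from has_vector_derivative_real_field[OF this] show ?thesis by simp
  qed
  moreover have "p \<circ> (\<lambda>t. t *\<^sub>R x) = (\<lambda>t. of_real t ^ m * p x)"
    using hom by auto
  ultimately have "(\<Sum>i\<in>UNIV. (x $ i) *\<^sub>R partial_deriv i p x) = of_nat m * p x"
    by (simp add: vector_derivative_unique_at)
  then show ?thesis
    by (simp add: scaleR_conv_of_real)
qed

definition norm_sq :: "real^'n \<Rightarrow> complex" where
  "norm_sq x = of_real ((norm x)\<^sup>2)"

lemma norm_sq_alt: "norm_sq x = (\<Sum>i\<in>UNIV. of_real (x $ i) ^ 2)"
  unfolding norm_sq_def power2_norm_eq_inner inner_vec_def by (simp add: power2_eq_square)

lemma polynomial_function_component: "polynomial_function (\<lambda>x::real^'n. complex_of_real (x $ i))"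
  by (intro polynomial_function_of_real real_polynomial_function.intros(1) bounded_linear_vec_nth)

lemma polynomial_function_norm_sq: "polynomial_function (norm_sq :: real^'n \<Rightarrow> complex)"
  unfolding norm_sq_alt[abs_def] power2_eq_square
  by (intro polynomial_function_sum polynomial_function_times polynomial_function_component) auto

lemma polynomial_function_power:
  fixes p :: "'a::euclidean_space \<Rightarrow> complex"
  shows "polynomial_function p \<Longrightarrow> polynomial_function (\<lambda>x. p x ^ j)"
  by (induction j) (auto intro: polynomial_function_times)

lemma partial_deriv_component:
  "partial_deriv i (\<lambda>x::real^'n. complex_of_real (x $ j)) = (\<lambda>x. if i = j then 1 else 0)"
proof
  fix x :: "real^'n"
  have "((\<lambda>x::real^'n. complex_of_real (x $ j)) has_derivative (\<lambda>x. complex_of_real (x $ j))) (at x)"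
    by (intro bounded_linear_imp_has_derivative bounded_linear_compose[OF bounded_linear_of_real bounded_linear_vec_nth])
  from partial_deriv_eqI[OF this, of i]
  show "partial_deriv i (\<lambda>x::real^'n. complex_of_real (x $ j)) x = (if i = j then 1 else 0)"
    by (auto simp: axis_def)
qed

lemma partial_deriv_norm_sq: "partial_deriv i norm_sq = (\<lambda>x::real^'n. 2 * of_real (x $ i))"
proof -
  have "partial_deriv i (\<lambda>x::real^'n. \<Sum>j\<in>UNIV. 1 * (complex_of_real (x $ j) * complex_of_real (x $ j)))
    = (\<lambda>x. 2 * of_real (x $ i))"
    by (subst partial_deriv_sum)
      (auto simp: polynomial_function_times polynomial_function_component partial_deriv_times
        partial_deriv_component fun_eq_iff if_distrib[of "\<lambda>u. _ * u"] if_distrib[of "\<lambda>u. u * _"] sum.distrib cong: if_cong)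
  then show ?thesis
    by (simp add: norm_sq_alt[abs_def] power2_eq_square)
qed

text \<open>Leibniz rule: the mixed term is 4 x . grad q, which Euler's identity turns into 4 m q,
  and the Laplacian of |x|^2 contributes 2 n q in dimension n.\<close>

lemma laplacian_norm_sq_times:
  fixes q :: "real^'n \<Rightarrow> complex"
  assumes q: "polynomial_function q" and hom: "\<And>t x. q (t *\<^sub>R x) = of_real t ^ m * q x"
  shows "laplacian (\<lambda>x. norm_sq x * q x) =
    (\<lambda>x. of_nat (2 * CARD('n) + 4 * m) * q x + norm_sq x * laplacian q x)"
proof
  fix x :: "real^'n"
  \<comment> \<open>Written as a sum over the Booleans with coefficients 1, the product rule has the
    shape that \<open>partial_deriv_sum\<close> differentiates.\<close>
  have D1: "partial_deriv i (\<lambda>x. norm_sq x * q x) =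
      (\<lambda>x. \<Sum>b\<in>{True, False}. 1 * (if b then norm_sq x * partial_deriv i q x else 2 * of_real (x $ i) * q x))" for i
    by (auto simp: partial_deriv_times[OF polynomial_function_norm_sq q] partial_deriv_norm_sq)
  have pp: "polynomial_function (\<lambda>x. norm_sq x * partial_deriv i q x)"
    "polynomial_function (\<lambda>x. (2 * of_real (x $ i)) * q x)"
    "polynomial_function (\<lambda>x::real^'n. 2 * complex_of_real (x $ i))" for i
    by (intro polynomial_function_times polynomial_function_partial_deriv polynomial_function_const
        polynomial_function_norm_sq polynomial_function_component q)+
  have p2: "partial_deriv i (\<lambda>x::real^'n. 2 * complex_of_real (x $ i)) = (\<lambda>x. 2)" for i
    using partial_deriv_sum[of "{()}" "\<lambda>_ x. complex_of_real (x $ i)" i "\<lambda>_. 2"]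
    by (simp add: polynomial_function_component partial_deriv_component)
  have pif: "polynomial_function (\<lambda>x. if b then norm_sq x * partial_deriv i q x else 2 * of_real (x $ i) * q x)" for b i
    using pp by (cases b) auto
  have D2: "partial_deriv i (partial_deriv i (\<lambda>x. norm_sq x * q x)) x =
      2 * q x + 4 * (of_real (x $ i) * partial_deriv i q x) + norm_sq x * partial_deriv i (partial_deriv i q) x" for i
    unfolding D1
    by (subst partial_deriv_sum[OF pif])
       (simp add: partial_deriv_times pp polynomial_function_partial_deriv q p2 polynomial_function_norm_sq
          partial_deriv_norm_sq algebra_simps)
  show "laplacian (\<lambda>x. norm_sq x * q x) x = of_nat (2 * CARD('n) + 4 * m) * q x + norm_sq x * laplacian q x"
    unfolding laplacian_def D2
    by (simp only: sum.distrib sum_distrib_left[symmetric] euler_homogeneous[OF q hom])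
       (simp add: algebra_simps)
qed

lemma norm_sq_scaleR: "norm_sq (t *\<^sub>R x) = of_real t ^ 2 * norm_sq x"
  by (simp add: norm_sq_def power_mult_distrib)

text \<open>Closed form: 2 j (n + 2 k + 2 j - 2). Each further factor |x|^2 contributes 2 n plus
  four times the current degree. In the naturals positivity for j > 0 and n > 0 is evident.\<close>

primrec radial_factor :: "nat \<Rightarrow> nat \<Rightarrow> nat \<Rightarrow> nat" where
  "radial_factor n k 0 = 0"
| "radial_factor n k (Suc j) = 2 * n + 4 * (k + 2 * j) + radial_factor n k j"

lemma harmonicsD:
  assumes "h \<in> harmonics k"
  shows "polynomial_function h" "h (t *\<^sub>R x) = of_real t ^ k * h x" "laplacian h = (\<lambda>x. 0)"
  using assms by (auto simp: harmonics_def)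

lemma polynomial_function_norm_sq_power_times:
  fixes h :: "real^'n \<Rightarrow> complex"
  assumes "polynomial_function h"
  shows "polynomial_function (\<lambda>x. norm_sq x ^ j * h x)"
  by (intro polynomial_function_times polynomial_function_power polynomial_function_norm_sq assms)

text \<open>Induction on j: the factor |x|^2 split off meets a polynomial homogeneous of degree k +
  2 j, and harmonicity of \<open>h\<close> starts the recursion at 0. For j = 0 the factor is 0, so
  the truncated exponent j - 1 does no harm.\<close>

lemma laplacian_norm_sq_power:
  fixes h :: "real^'n \<Rightarrow> complex"
  assumes h: "h \<in> harmonics k"
  shows "laplacian (\<lambda>x. norm_sq x ^ j * h x) =
    (\<lambda>x. of_nat (radial_factor CARD('n) k j) * (norm_sq x ^ (j - 1) * h x))"
proof (induction j)
  case 0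
  then show ?case using harmonicsD[OF h] by simp
next
  case (Suc j)
  have hom: "norm_sq (t *\<^sub>R x) ^ j * h (t *\<^sub>R x) = of_real t ^ (k + 2 * j) * (norm_sq x ^ j * h x)" for t x
    by (simp add: norm_sq_scaleR harmonicsD[OF h] power_mult_distrib power_add power_mult)
  have "laplacian (\<lambda>x. norm_sq x ^ Suc j * h x) = laplacian (\<lambda>x. norm_sq x * (norm_sq x ^ j * h x))"
    by (simp add: mult.assoc)
  also have "\<dots> = (\<lambda>x. of_nat (2 * CARD('n) + 4 * (k + 2 * j)) * (norm_sq x ^ j * h x)
      + norm_sq x * laplacian (\<lambda>x. norm_sq x ^ j * h x) x)"
    by (intro laplacian_norm_sq_times polynomial_function_norm_sq_power_times harmonicsD[OF h] hom)
  also have "\<dots> = (\<lambda>x. of_nat (radial_factor CARD('n) k (Suc j)) * (norm_sq x ^ (Suc j - 1) * h x))"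
    unfolding Suc.IH by (cases j) (auto simp: fun_eq_iff algebra_simps)
  finally show ?case .
qed

text \<open>Polynomiality of the iterates is carried through the induction because linearity of the
  next Laplacian rests on it.\<close>

lemma laplacian_funpow_sum:
  fixes p :: "'i \<Rightarrow> real^'n \<Rightarrow> complex"
  assumes "finite J" "\<And>j. j \<in> J \<Longrightarrow> polynomial_function (p j)"
  shows "(laplacian ^^ N) (\<lambda>x. \<Sum>j\<in>J. c j * p j x) = (\<lambda>x. \<Sum>j\<in>J. c j * (laplacian ^^ N) (p j) x) \<and>
    (\<forall>j\<in>J. polynomial_function ((laplacian ^^ N) (p j)))"
  by (induction N) (auto simp: assms laplacian_sum polynomial_function_laplacian)

text \<open>Both directions of the condition on \<open>a\<close> matter: terms with j < N are
  annihilated, while for N \<le> j a nonzero multiple survives.\<close>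

lemma laplacian_funpow_norm_sq_power:
  fixes h :: "real^'n \<Rightarrow> complex"
  assumes h: "h \<in> harmonics k"
  shows "\<exists>a. (laplacian ^^ N) (\<lambda>x. norm_sq x ^ j * h x) = (\<lambda>x. a * (norm_sq x ^ (j - N) * h x)) \<and>
    (a \<noteq> 0 \<longleftrightarrow> N \<le> j)"
proof (induction N)
  case 0
  then show ?case by (auto intro: exI[of _ 1])
next
  case (Suc N)
  then obtain a where a: "(laplacian ^^ N) (\<lambda>x. norm_sq x ^ j * h x) = (\<lambda>x. a * (norm_sq x ^ (j - N) * h x))"
    "a \<noteq> 0 \<longleftrightarrow> N \<le> j" by blast
  have "radial_factor CARD('n) k (j - N) \<noteq> 0 \<longleftrightarrow> N < j"
    by (cases "j - N") auto
  with a show ?case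
    by (intro exI[of _ "a * of_nat (radial_factor CARD('n) k (j - N))"])
       (auto simp: laplacian_cmul laplacian_norm_sq_power[OF h]
          polynomial_function_norm_sq_power_times harmonicsD[OF h])
qed

text \<open>Uniqueness in the Almansi decomposition. Let M be the largest index of a nonzero
  component. M Laplacians kill the terms below M, those above M are zero by the choice of M, and at
  M a nonzero multiple of \<open>h M\<close> remains.\<close>

lemma harmonic_components_zero:
  fixes h :: "nat \<Rightarrow> real^'n \<Rightarrow> complex"
  assumes h: "\<And>j. j \<le> J \<Longrightarrow> h j \<in> harmonics (k j)"
    and 0: "\<And>x. (\<Sum>j\<le>J. norm_sq x ^ j * h j x) = 0"
    and j: "j \<le> J"
  shows "h j x = 0"
proof (rule ccontr)
  assume "h j x \<noteq> 0"
  define S where "S = {i. i \<le> J \<and> (\<exists>x. h i x \<noteq> 0)}"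
  have "finite S" "j \<in> S" using \<open>h j x \<noteq> 0\<close> j by (auto simp: S_def)
  define M where "M = Max S"
  have M: "M \<in> S" "\<And>i. i \<in> S \<Longrightarrow> i \<le> M"
    using \<open>finite S\<close> \<open>j \<in> S\<close> unfolding M_def by (auto intro: Max_in)
  then obtain y where y: "h M y \<noteq> 0" by (auto simp: S_def)
  have pol: "polynomial_function (\<lambda>x. norm_sq x ^ i * h i x)" if "i \<in> {..J}" for i
    using that h harmonicsD polynomial_function_norm_sq_power_times by blast
  have "(laplacian ^^ M) (\<lambda>x. \<Sum>i\<le>J. 1 * (norm_sq x ^ i * h i x)) y =
      (\<Sum>i\<le>J. (laplacian ^^ M) (\<lambda>x. norm_sq x ^ i * h i x) y)"
    using laplacian_funpow_sum[of "{..J}" "\<lambda>i x. norm_sq x ^ i * h i x" M "\<lambda>_. 1"] pol by simp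
  also have "\<dots> = (\<Sum>i\<in>{M}. (laplacian ^^ M) (\<lambda>x. norm_sq x ^ i * h i x) y)"
  proof (rule sum.mono_neutral_right)
    show "\<forall>i\<in>{..J} - {M}. (laplacian ^^ M) (\<lambda>x. norm_sq x ^ i * h i x) y = 0"
    proof
      fix i assume i: "i \<in> {..J} - {M}"
      obtain a where a: "(laplacian ^^ M) (\<lambda>x. norm_sq x ^ i * h i x) = (\<lambda>x. a * (norm_sq x ^ (i - M) * h i x))"
        "a \<noteq> 0 \<longleftrightarrow> M \<le> i" using laplacian_funpow_norm_sq_power h i by blast
      show "(laplacian ^^ M) (\<lambda>x. norm_sq x ^ i * h i x) y = 0"
      proof (cases "M < i")
        case True
        then have "i \<notin> S" using M(2) by force
        then show ?thesis using i a by (simp add: S_def)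
      qed (use a i in auto)
    qed
  qed (use M in \<open>auto simp: S_def\<close>)
  also have "\<dots> \<noteq> 0"
    using laplacian_funpow_norm_sq_power[of "h M" "k M" M M] h M y by (auto simp: S_def)
  \<comment> \<open>The instance with the empty index set says that iterated Laplacians of the zero
    function vanish, and by \<open>0\<close> the whole sum is that function.\<close>
  finally show False
    using laplacian_funpow_sum[of "{} :: unit set" "\<lambda>_ (_::real^'n). 0" M "\<lambda>_. 0"] unfolding sum.empty by (simp add: 0)
qed

section \<open>Rotation invariance of harmonics\<close>

lemma partial_deriv_linear_compose:
  fixes p :: "real^'n \<Rightarrow> complex" and A :: "real^'n^'n"
  assumes "polynomial_function p"
  shows "partial_deriv i (\<lambda>x. p (A *v x)) = (\<lambda>x. \<Sum>a\<in>UNIV. of_real (A $ a $ i) * partial_deriv a p (A *v x))"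
proof
  fix x :: "real^'n"
  have "((\<lambda>x. A *v x) has_derivative (\<lambda>x. A *v x)) (at x)"
    by (intro linear_imp_has_derivative matrix_vector_mul_linear)
  from has_derivative_compose[OF this polynomial_has_derivative[OF assms, of "A *v x"]]
  have "partial_deriv i (\<lambda>x. p (A *v x)) x = (\<Sum>a\<in>UNIV. ((A *v axis i 1) $ a) *\<^sub>R partial_deriv a p (A *v x))"
    by (rule partial_deriv_eqI)
  then show "partial_deriv i (\<lambda>x. p (A *v x)) x = (\<Sum>a\<in>UNIV. of_real (A $ a $ i) * partial_deriv a p (A *v x))"
    by (simp add: matrix_vector_mul_component scaleR_conv_of_real inner_axis)
qed

lemma laplacian_rotation:
  fixes p :: "real^'n \<Rightarrow> complex" and A :: "real^'n^'n"
  assumes p: "polynomial_function p" and A: "orthogonal_matrix A"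
  shows "laplacian (\<lambda>x. p (A *v x)) = (\<lambda>x. laplacian p (A *v x))"
proof
  fix x :: "real^'n"
  have pa: "polynomial_function (\<lambda>x. partial_deriv a p (A *v x))" for a
    by (rule polynomial_function_linear_compose[of _ "(*v) A"])
       (auto intro: polynomial_function_partial_deriv p)
  \<comment> \<open>Orthonormality of the rows of \<open>A\<close>; it collapses the double sum of
    second derivatives to its diagonal.\<close>
  have AA: "(\<Sum>i\<in>UNIV. of_real (A $ a $ i) * complex_of_real (A $ b $ i)) = (if a = b then 1 else 0)" for a b
  proof -
    have "(A ** transpose A) $ a $ b = (if a = b then 1 else 0)"
      using A by (simp add: orthogonal_matrix_def mat_def)
    then have "(\<Sum>i\<in>UNIV. A $ a $ i * A $ b $ i) = (if a = b then 1 else 0)"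
      by (simp add: matrix_matrix_mult_def transpose_def)
    from arg_cong[OF this, of complex_of_real] show ?thesis
      by (simp split: if_splits)
  qed
  have "laplacian (\<lambda>x. p (A *v x)) x =
      (\<Sum>i\<in>UNIV. \<Sum>a\<in>UNIV. \<Sum>b\<in>UNIV. of_real (A $ a $ i) * of_real (A $ b $ i) * partial_deriv b (partial_deriv a p) (A *v x))"
    unfolding laplacian_def partial_deriv_linear_compose[OF p]
    by (subst partial_deriv_sum[OF pa])
       (simp add: partial_deriv_linear_compose[OF polynomial_function_partial_deriv[OF p]] sum_distrib_left mult.assoc)
  also have "\<dots> = (\<Sum>a\<in>UNIV. \<Sum>b\<in>UNIV. \<Sum>i\<in>UNIV. of_real (A $ a $ i) * of_real (A $ b $ i) * partial_deriv b (partial_deriv a p) (A *v x))"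
    by (subst sum.swap) (intro sum.cong refl sum.swap)
  also have "\<dots> = (\<Sum>a\<in>UNIV. \<Sum>b\<in>UNIV. (if a = b then 1 else 0) * partial_deriv b (partial_deriv a p) (A *v x))"
    by (simp only: sum_distrib_right[symmetric] AA)
  also have "\<dots> = laplacian p (A *v x)"
    by (simp add: laplacian_def if_distrib[of "\<lambda>u. u * _"] cong: if_cong)
  finally show "laplacian (\<lambda>x. p (A *v x)) x = laplacian p (A *v x)" .
qed

lemma harmonics_rotation:
  fixes h :: "real^'n \<Rightarrow> complex" and A :: "real^'n^'n"
  assumes "h \<in> harmonics k" "orthogonal_matrix A"
  shows "(\<lambda>x. h (A *v x)) \<in> harmonics k"
  using assms harmonicsD[OF assms(1)]
  by (auto simp: harmonics_def laplacian_rotation matrix_vector_mult_scaleR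
      intro!: polynomial_function_linear_compose[of h "(*v) A"])

section \<open>Power series in the Hardy space of the disc\<close>

lemma integral_cis_multiple:
  assumes "k \<noteq> 0"
  shows "((\<lambda>\<phi>. cis (of_int k * \<phi>)) has_integral 0) {0..2 * pi}"
proof -
  have "((\<lambda>\<phi>. cis (of_int k * \<phi>)) has_integral
      (cis (of_int k * (2 * pi)) / (\<i> * of_int k) - cis (of_int k * 0) / (\<i> * of_int k))) {0..2 * pi}"
  proof (rule fundamental_theorem_of_calculus)
    fix x :: real
    have "((\<lambda>z. exp (\<i> * (of_int k * z)) / (\<i> * of_int k)) has_field_derivative
        exp (\<i> * (of_int k * of_real x))) (at (of_real x))"
      using assms by (auto intro!: derivative_eq_intros simp: ac_simps)
    from has_vector_derivative_real_field[OF this]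
    show "((\<lambda>\<phi>. cis (of_int k * \<phi>) / (\<i> * of_int k)) has_vector_derivative cis (of_int k * x)) (at x within {0..2 * pi})"
      by (simp add: cis_conv_exp has_vector_derivative_at_within)
  qed simp
  moreover have "cis (of_int k * (2 * pi)) = 1"
    using cis_multiple_2pi[of "of_int k"] by (simp add: ac_simps)
  ultimately show ?thesis by simp
qed

lemma cmod_sum_squared:
  fixes w :: "nat \<Rightarrow> complex"
  shows "complex_of_real ((cmod (\<Sum>n<N. w n))\<^sup>2) = (\<Sum>n<N. \<Sum>m<N. w n * cnj (w m))"
  by (simp only: complex_norm_square cnj_sum sum_product)

text \<open>Expand the squared modulus as a double sum: off the diagonal the integrand is a
  nontrivial character with integral zero, on the diagonal it is constant.\<close>

lemma integral_trig_polynomial: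
  fixes w :: "nat \<Rightarrow> complex"
  shows "((\<lambda>\<phi>. (cmod (\<Sum>n<N. w n * cis (of_nat n * \<phi>)))\<^sup>2) has_integral
    (2 * pi * (\<Sum>n<N. (cmod (w n))\<^sup>2))) {0..2 * pi}"
proof -
  have "((\<lambda>\<phi>. \<Sum>n<N. \<Sum>m<N. w n * cnj (w m) * cis (of_int (int n - int m) * \<phi>)) has_integral
      (\<Sum>n<N. \<Sum>m<N. w n * cnj (w m) * (if n = m then of_real (2 * pi) else 0))) {0..2 * pi}"
  proof (intro has_integral_sum has_integral_mult_right finite_lessThan)
    fix n m :: nat
    show "((\<lambda>\<phi>. cis (of_int (int n - int m) * \<phi>)) has_integral (if n = m then of_real (2 * pi) else 0)) {0..2 * pi}"
    proof (cases "n = m")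
      case True
      then show ?thesis using has_integral_const_real[of "1 :: complex" 0 "2 * pi"]
        by (simp add: scaleR_conv_of_real)
    next
      case False
      then show ?thesis using integral_cis_multiple[of "int n - int m"] by simp
    qed
  qed
  also have "(\<lambda>\<phi>. \<Sum>n<N. \<Sum>m<N. w n * cnj (w m) * cis (of_int (int n - int m) * \<phi>)) =
      (\<lambda>\<phi>. complex_of_real ((cmod (\<Sum>n<N. w n * cis (of_nat n * \<phi>)))\<^sup>2))"
    unfolding cmod_sum_squared
    by (intro ext sum.cong refl) (simp add: cis_cnj left_diff_distrib cis_divide[symmetric] cis_inverse[symmetric] field_simps cis_mult)
  also have "(\<Sum>n<N. \<Sum>m<N. w n * cnj (w m) * (if n = m then of_real (2 * pi) else 0)) =
      complex_of_real (2 * pi * (\<Sum>n<N. (cmod (w n))\<^sup>2))"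
    by (simp add: if_distrib[of "\<lambda>u. _ * u"] complex_norm_square sum_distrib_left algebra_simps cong: if_cong del: of_real_power)
  finally have "((\<lambda>\<phi>. complex_of_real ((cmod (\<Sum>n<N. w n * cis (of_nat n * \<phi>)))\<^sup>2)) has_integral
      complex_of_real (2 * pi * (\<Sum>n<N. (cmod (w n))\<^sup>2))) {0..2 * pi}" .
  from has_integral_linear[OF this bounded_linear_Re] show ?thesis
    by (simp only: o_def Re_complex_of_real)
qed

text \<open>The partial sums are trigonometric polynomials bounded by the sum of |a_n| r^n, so
  dominated convergence carries the finite Parseval identity to the limit.\<close>

lemma power_series_circle_mean:
  assumes a: "\<And>z. z \<in> ball 0 1 \<Longrightarrow> (\<lambda>n. a n * z ^ n) sums g z" and r: "0 \<le> r" "r < 1"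
  shows "(\<lambda>n. (cmod (a n))\<^sup>2 * (r\<^sup>2) ^ n) sums circle_mean g r"
proof -
  \<comment> \<open>Convergence at a point beyond r gives absolute convergence at radius r.\<close>
  obtain s where s: "r < s" "s < 1" using r dense by blast
  have "summable (\<lambda>n. a n * of_real s ^ n)"
    using a[of "of_real s"] s r by (auto simp: sums_iff)
  then have "summable (\<lambda>n. norm (a n * of_real r ^ n))"
    by (rule powser_insidea) (use s r in auto)
  then have summ: "summable (\<lambda>n. cmod (a n) * r ^ n)"
    using r by (simp add: norm_mult norm_power)
  define S where "S N \<phi> = (\<Sum>n<N. (a n * of_real r ^ n) * cis (of_nat n * \<phi>))" for N \<phi>
  have powcis: "a n * (of_real r * cis \<phi>) ^ n = (a n * of_real r ^ n) * cis (of_nat n * \<phi>)" for n \<phi>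
    by (simp add: power_mult_distrib Complex.DeMoivre)
  have lim: "(\<lambda>N. S N \<phi>) \<longlonglongrightarrow> g (of_real r * cis \<phi>)" for \<phi>
    using a[of "of_real r * cis \<phi>"] r by (simp add: norm_mult S_def sums_def powcis)
  have bound: "cmod (S N \<phi>) \<le> (\<Sum>n. cmod (a n) * r ^ n)" for N \<phi>
  proof -
    have "cmod (S N \<phi>) \<le> (\<Sum>n<N. cmod (a n) * r ^ n)"
      unfolding S_def using r by (intro sum_norm_le) (simp add: norm_mult norm_power)
    also have "\<dots> \<le> (\<Sum>n. cmod (a n) * r ^ n)"
      using summ r by (intro sum_le_suminf) auto
    finally show ?thesis .
  qed
  have int: "((\<lambda>\<phi>. (cmod (S N \<phi>))\<^sup>2) has_integral (2 * pi * (\<Sum>n<N. (cmod (a n))\<^sup>2 * (r\<^sup>2) ^ n))) {0..2 * pi}" for N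
  proof -
    have "(cmod (a n * of_real r ^ n))\<^sup>2 = (cmod (a n))\<^sup>2 * (r\<^sup>2) ^ n" for n
      using r by (simp add: norm_mult norm_power power_mult_distrib power_mult[symmetric] mult.commute)
    then show ?thesis
      using integral_trig_polynomial[of "\<lambda>n. a n * of_real r ^ n" N] by (simp add: S_def)
  qed
  have "(\<lambda>N. integral {0..2 * pi} (\<lambda>\<phi>. (cmod (S N \<phi>))\<^sup>2)) \<longlonglongrightarrow>
      integral {0..2 * pi} (\<lambda>\<phi>. (cmod (g (of_real r * cis \<phi>)))\<^sup>2)"
  proof (rule dominated_convergence(2))
    show "(\<lambda>\<phi>. (cmod (S N \<phi>))\<^sup>2) integrable_on {0..2 * pi}" for N
      using int by blast
    show "(\<lambda>\<phi>. (\<Sum>n. cmod (a n) * r ^ n)\<^sup>2) integrable_on {0..2 * pi}"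
      by (rule integrable_const_ivl)
    show "norm ((cmod (S N \<phi>))\<^sup>2) \<le> (\<Sum>n. cmod (a n) * r ^ n)\<^sup>2" for N \<phi>
      using bound[of N \<phi>] by (simp add: power_mono)
    show "(\<lambda>N. (cmod (S N \<phi>))\<^sup>2) \<longlonglongrightarrow> (cmod (g (of_real r * cis \<phi>)))\<^sup>2" for \<phi>
      by (intro tendsto_intros lim)
  qed
  then have "(\<lambda>N. 1 / (2 * pi) * (2 * pi * (\<Sum>n<N. (cmod (a n))\<^sup>2 * (r\<^sup>2) ^ n))) \<longlonglongrightarrow> circle_mean g r"
    unfolding circle_mean_def integral_unique[OF int] by (rule tendsto_mult_left)
  then show ?thesis by (simp add: sums_def)
qed

lemma sum_le_sums:
  fixes f :: "nat \<Rightarrow> real"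
  assumes "f sums s" "\<And>n. 0 \<le> f n"
  shows "(\<Sum>n<N. f n) \<le> s"
  using sum_le_suminf[OF sums_summable[OF assms(1)], of "{..<N}"] sums_unique[OF assms(1)] assms(2)
  by simp

text \<open>The circle mean is the sum of |a_n|^2 r^(2n). It never exceeds the full sum, and a
  finite section close to the full sum is nearly reached as r tends to 1, so limit and supremum
  agree.\<close>

lemma power_series_hardy_norm:
  assumes a: "\<And>z. z \<in> ball 0 1 \<Longrightarrow> (\<lambda>n. a n * z ^ n) sums g z"
    and s: "summable (\<lambda>n. (cmod (a n))\<^sup>2)"
  shows "(circle_mean g \<longlongrightarrow> (\<Sum>n. (cmod (a n))\<^sup>2)) (at_left 1)"
    and "\<forall>r\<in>{0..<1}. circle_mean g r \<le> (\<Sum>n. (cmod (a n))\<^sup>2)"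
    and "(hardy_norm g)\<^sup>2 = (\<Sum>n. (cmod (a n))\<^sup>2)"
proof -
  let ?A = "\<Sum>n. (cmod (a n))\<^sup>2"
  note cm = power_series_circle_mean[OF a]
  have le1: "(r\<^sup>2) ^ n \<le> 1" if "0 \<le> r" "r < 1" for r :: real and n
    using that by (simp add: power_le_one abs_square_le_1)
  show ub: "\<forall>r\<in>{0..<1}. circle_mean g r \<le> ?A"
  proof
    fix r :: real assume r: "r \<in> {0..<1}"
    show "circle_mean g r \<le> ?A"
      by (rule sums_le[OF _ cm summable_sums[OF s]])
        (use r le1 in \<open>auto intro!: mult_left_le\<close>)
  qed
  show lim: "(circle_mean g \<longlongrightarrow> ?A) (at_left 1)"
  proof (rule order_tendstoI)
    fix y assume "y < ?A"
    then obtain N where N: "y < (\<Sum>n<N. (cmod (a n))\<^sup>2)"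
      using order_tendstoD(1)[OF summable_LIMSEQ[OF s]] eventually_happens by fastforce
    have "((\<lambda>r. \<Sum>n<N. (cmod (a n))\<^sup>2 * (r\<^sup>2) ^ n) \<longlongrightarrow> (\<Sum>n<N. (cmod (a n))\<^sup>2 * (1\<^sup>2) ^ n)) (at_left 1)"
      by (intro tendsto_intros)
    then have "eventually (\<lambda>r. y < (\<Sum>n<N. (cmod (a n))\<^sup>2 * (r\<^sup>2) ^ n)) (at_left 1)"
      using N by (auto dest: order_tendstoD)
    moreover have "eventually (\<lambda>r. r \<in> {0<..<1}) (at_left (1::real))"
      by (rule eventually_at_left_real) simp
    ultimately show "eventually (\<lambda>r. y < circle_mean g r) (at_left 1)"
    proof eventually_elim
      case (elim r)
      have "(\<Sum>n<N. (cmod (a n))\<^sup>2 * (r\<^sup>2) ^ n) \<le> circle_mean g r"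
        using elim by (intro sum_le_sums cm) auto
      then show ?case using elim by simp
    qed
  next
    fix y assume "?A < y"
    moreover have "eventually (\<lambda>r. r \<in> {0<..<1}) (at_left (1::real))"
      by (rule eventually_at_left_real) simp
    ultimately show "eventually (\<lambda>r. circle_mean g r < y) (at_left 1)"
      using ub by (auto elim!: eventually_mono intro: le_less_trans)
  qed
  have "(SUP r\<in>{0..<1}. circle_mean g r) = ?A"
  proof (rule antisym)
    show "(SUP r\<in>{0..<1}. circle_mean g r) \<le> ?A"
      using ub by (intro cSUP_least) auto
    have bdd: "bdd_above (circle_mean g ` {0..<1})"
      using ub by (auto intro!: bdd_aboveI2)
    show "?A \<le> (SUP r\<in>{0..<1}. circle_mean g r)"
    proof (rule tendsto_upperbound[OF lim])
      have "eventually (\<lambda>r. r \<in> {0<..<1}) (at_left (1::real))"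
        by (rule eventually_at_left_real) simp
      then show "\<forall>\<^sub>F r in at_left 1. circle_mean g r \<le> (SUP r\<in>{0..<1}. circle_mean g r)"
        by (rule eventually_mono) (auto intro: cSUP_upper bdd)
    qed simp
  qed
  then show "(hardy_norm g)\<^sup>2 = ?A"
    by (simp add: hardy_norm_def suminf_nonneg s)
qed

lemma power_series_in_hardy:
  assumes a: "\<And>z. z \<in> ball 0 1 \<Longrightarrow> (\<lambda>n. a n * z ^ n) sums g z"
    and s: "summable (\<lambda>n. (cmod (a n))\<^sup>2)"
  shows "g \<in> hardy"
proof -
  have "g holomorphic_on ball 0 1"
    using power_series_holomorphic[of 0 1 a g] a by simp
  moreover have "bdd_above (circle_mean g ` {0..<1})"
    using power_series_hardy_norm(2)[OF a s] by (auto intro!: bdd_aboveI2)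
  ultimately show ?thesis by (simp add: hardy_def)
qed

text \<open>Take the Taylor coefficients. Every finite section of the Parseval sum is at most the
  bound C on the circle means; letting r tend to 1 with N fixed bounds the sections of the sum of
  |a_n|^2.\<close>

lemma hardy_power_series:
  assumes "g \<in> hardy"
  obtains a where "summable (\<lambda>n. (cmod (a n))\<^sup>2)" "\<And>z. z \<in> ball 0 1 \<Longrightarrow> (\<lambda>n. a n * z ^ n) sums g z"
proof -
  define a where "a n = (deriv ^^ n) g 0 / fact n" for n
  have a: "(\<lambda>n. a n * z ^ n) sums g z" if "z \<in> ball 0 1" for z
    using holomorphic_power_series[of g 0 1 z] assms that by (simp add: hardy_def a_def)
  obtain C where C: "\<And>r. r \<in> {0..<1} \<Longrightarrow> circle_mean g r \<le> C"
    using assms cSUP_upper[of _ "{0..<1::real}" "circle_mean g"] unfolding hardy_def by blast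
  have "(\<Sum>n<N. (cmod (a n))\<^sup>2) \<le> C" for N
  proof (rule tendsto_upperbound)
    show "((\<lambda>r. \<Sum>n<N. (cmod (a n))\<^sup>2 * (r\<^sup>2) ^ n) \<longlongrightarrow> (\<Sum>n<N. (cmod (a n))\<^sup>2)) (at_left (1::real))"
      by (rule tendsto_eq_intros refl | simp)+
    have "eventually (\<lambda>r. r \<in> {0<..<1}) (at_left (1::real))"
      by (rule eventually_at_left_real) simp
    then show "\<forall>\<^sub>F r in at_left 1. (\<Sum>n<N. (cmod (a n))\<^sup>2 * (r\<^sup>2) ^ n) \<le> C"
    proof eventually_elim
      case (elim r)
      have "(\<Sum>n<N. (cmod (a n))\<^sup>2 * (r\<^sup>2) ^ n) \<le> circle_mean g r"
        using elim by (intro sum_le_sums power_series_circle_mean a) auto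
      then show ?case using C[of r] elim by simp
    qed
  qed simp
  then have "summable (\<lambda>n. (cmod (a n))\<^sup>2)"
    by (intro summableI_nonneg_bounded) auto
  with a show ?thesis using that by blast
qed

lemma power_series_zero_coeffs:
  fixes w :: "nat \<Rightarrow> complex"
  assumes "\<And>z. z \<in> ball 0 1 \<Longrightarrow> (\<lambda>n. w n * z ^ n) sums 0"
  shows "w m = 0"
proof (rule ccontr)
  assume "w m \<noteq> 0"
  show False
  proof (cases "m = 0")
    case True
    then show ?thesis using assms[of 0] \<open>w m \<noteq> 0\<close> by simp
  next
    case False
    \<comment> \<open>A nonzero coefficient of positive index would make the sum nonzero on a
      punctured disc, but the sum is the zero function. Index 0 was settled by evaluation at
      0.\<close>
    obtain s where s: "0 < s" "\<And>z::complex. z \<in> cball 0 s - {0} \<Longrightarrow> (0::complex) \<noteq> 0"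
      by (rule powser_0_nonzero[of 1 0 w "\<lambda>_. 0" m]) (use assms False \<open>w m \<noteq> 0\<close> in auto)
    then show False using s(2)[of "of_real s"] by simp
  qed
qed

section \<open>Power series in the exponents k + 2 j\<close>

text \<open>Padding with zeros turns a series in the powers k + 2 j into an ordinary power series,
  to which the results above apply.\<close>

definition spread_coeffs :: "nat \<Rightarrow> (nat \<Rightarrow> complex) \<Rightarrow> nat \<Rightarrow> complex" where
  "spread_coeffs k c n = (if n \<in> range (\<lambda>j. k + 2 * j) then c ((n - k) div 2) else 0)"

lemma spread_coeffs:
  shows "(\<lambda>n. spread_coeffs k c n * z ^ n) sums s \<longleftrightarrow> (\<lambda>j. c j * z ^ (k + 2 * j)) sums s"
    and "(\<lambda>n. (cmod (spread_coeffs k c n))\<^sup>2) sums t \<longleftrightarrow> (\<lambda>j. (cmod (c j))\<^sup>2) sums t"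
proof -
  have m: "strict_mono (\<lambda>j. k + 2 * j)" by (auto intro: strict_monoI)
  show "(\<lambda>n. spread_coeffs k c n * z ^ n) sums s \<longleftrightarrow> (\<lambda>j. c j * z ^ (k + 2 * j)) sums s"
    by (subst sums_mono_reindex[OF m, symmetric]) (auto simp: spread_coeffs_def)
  show "(\<lambda>n. (cmod (spread_coeffs k c n))\<^sup>2) sums t \<longleftrightarrow> (\<lambda>j. (cmod (c j))\<^sup>2) sums t"
    by (subst sums_mono_reindex[OF m, symmetric]) (auto simp: spread_coeffs_def)
qed

lemma hardy_parity_norm:
  assumes c: "\<And>z. z \<in> ball 0 1 \<Longrightarrow> (\<lambda>j. c j * z ^ (k + 2 * j)) sums g z"
    and s: "summable (\<lambda>j. (cmod (c j))\<^sup>2)"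
  shows "(hardy_norm g)\<^sup>2 = (\<Sum>j. (cmod (c j))\<^sup>2)"
    and "(circle_mean g \<longlongrightarrow> (\<Sum>j. (cmod (c j))\<^sup>2)) (at_left 1)"
proof -
  have a: "(\<lambda>n. spread_coeffs k c n * z ^ n) sums g z" if "z \<in> ball 0 1" for z
    using c[OF that] by (simp add: spread_coeffs(1))
  have t: "(\<lambda>n. (cmod (spread_coeffs k c n))\<^sup>2) sums (\<Sum>j. (cmod (c j))\<^sup>2)"
    using s by (simp add: spread_coeffs(2) summable_sums)
  show "(hardy_norm g)\<^sup>2 = (\<Sum>j. (cmod (c j))\<^sup>2)"
    "(circle_mean g \<longlongrightarrow> (\<Sum>j. (cmod (c j))\<^sup>2)) (at_left 1)"
    using power_series_hardy_norm[OF a sums_summable[OF t]] t by (simp_all add: sums_iff)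
qed

text \<open>By 2 a b \<le> a^2 + b^2 with a = |c_j| and b = |w|^j, the terms are dominated by a
  summable family plus a geometric one.\<close>

lemma square_summable_power_series:
  fixes c :: "nat \<Rightarrow> complex"
  assumes "summable (\<lambda>j. (cmod (c j))\<^sup>2)" "cmod w < 1"
  shows "summable (\<lambda>j. c j * w ^ j)"
proof (rule summable_norm_cancel, rule summable_comparison_test'[where N = 0])
  have "summable (\<lambda>j. (cmod w ^ 2) ^ j)"
    using assms(2) by (intro summable_geometric) (simp add: abs_square_less_1)
  then show "summable (\<lambda>j. (cmod (c j))\<^sup>2 + (cmod w ^ 2) ^ j)"
    using assms(1) by (intro summable_add)
  fix j
  have "2 * (cmod (c j) * cmod w ^ j) \<le> (cmod (c j))\<^sup>2 + (cmod w ^ j)\<^sup>2"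
    using sum_squares_bound[of "cmod (c j)" "cmod w ^ j"] by simp
  moreover have "0 \<le> cmod (c j) * cmod w ^ j" by simp
  ultimately have "cmod (c j) * cmod w ^ j \<le> (cmod (c j))\<^sup>2 + (cmod w ^ j)\<^sup>2"
    by linarith
  then show "norm (norm (c j * w ^ j)) \<le> (cmod (c j))\<^sup>2 + (cmod w ^ 2) ^ j"
    by (simp add: norm_mult norm_power power_mult[symmetric] mult.commute)
qed

lemma power_add_double: "z ^ (k + 2 * j) = (z\<^sup>2) ^ j * z ^ k" for z :: complex
  by (simp add: power_add power_mult)

text \<open>The coefficient of z^j in \<open>g1\<close> is that of z^(k+2j) in \<open>g\<close>.
  Membership is used only in this coefficient form from here on.\<close>

lemma hardy_parity_iff:
  "g \<in> hardy_parity k \<longleftrightarrow> (\<exists>c. summable (\<lambda>j. (cmod (c j))\<^sup>2) \<and>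
     (\<forall>z\<in>ball 0 1. (\<lambda>j. c j * z ^ (k + 2 * j)) sums g z))"
proof
  assume "g \<in> hardy_parity k"
  then obtain g1 where g1: "g1 \<in> hardy" "\<forall>z\<in>ball 0 1. g z = g1 (z\<^sup>2) * z ^ k"
    by (auto simp: hardy_parity_def)
  obtain a where a: "summable (\<lambda>n. (cmod (a n))\<^sup>2)" "\<And>z. z \<in> ball 0 1 \<Longrightarrow> (\<lambda>n. a n * z ^ n) sums g1 z"
    using hardy_power_series[OF g1(1)] by blast
  have "(\<lambda>j. a j * z ^ (k + 2 * j)) sums g z" if "z \<in> ball 0 1" for z
  proof -
    have "z\<^sup>2 \<in> ball 0 1" using that by (simp add: norm_power abs_square_less_1)
    from sums_mult2[OF a(2)[OF this], of "z ^ k"] show ?thesis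
      using g1(2) that by (simp add: power_add_double mult.assoc)
  qed
  with a show "\<exists>c. summable (\<lambda>j. (cmod (c j))\<^sup>2) \<and>
     (\<forall>z\<in>ball 0 1. (\<lambda>j. c j * z ^ (k + 2 * j)) sums g z)" by blast
next
  assume "\<exists>c. summable (\<lambda>j. (cmod (c j))\<^sup>2) \<and>
     (\<forall>z\<in>ball 0 1. (\<lambda>j. c j * z ^ (k + 2 * j)) sums g z)"
  then obtain c where c: "summable (\<lambda>j. (cmod (c j))\<^sup>2)"
    "\<And>z. z \<in> ball 0 1 \<Longrightarrow> (\<lambda>j. c j * z ^ (k + 2 * j)) sums g z" by blast
  define g1 where "g1 z = (\<Sum>j. c j * z ^ j)" for z
  have g1: "(\<lambda>j. c j * w ^ j) sums g1 w" if "w \<in> ball 0 1" for w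
    unfolding g1_def using square_summable_power_series[OF c(1)] that by (simp add: summable_sums)
  have "g1 \<in> hardy" using power_series_in_hardy[OF g1 c(1)] .
  moreover have "g z = g1 (z\<^sup>2) * z ^ k" if "z \<in> ball 0 1" for z
  proof -
    have "z\<^sup>2 \<in> ball 0 1" using that by (simp add: norm_power abs_square_less_1)
    from sums_mult2[OF g1[OF this], of "z ^ k"] have "(\<lambda>j. c j * z ^ (k + 2 * j)) sums (g1 (z\<^sup>2) * z ^ k)"
      by (simp add: power_add_double mult.assoc)
    then show ?thesis using c(2)[OF that] sums_unique2 by blast
  qed
  ultimately show "g \<in> hardy_parity k" by (auto simp: hardy_parity_def)
qed

section \<open>Growth of spherical harmonics\<close>

lemma sum_fun_apply: "(\<Sum>i\<in>I. f i) x = (\<Sum>i\<in>I. f i x)"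
  by (induction I rule: infinite_finite_induct) auto

definition monomial :: "('n::finite \<Rightarrow> nat) \<Rightarrow> real^'n \<Rightarrow> complex" where
  "monomial \<alpha> x = (\<Prod>i\<in>UNIV. of_real (x $ i) ^ \<alpha> i)"

lemma monomial_mult: "monomial \<alpha> x * monomial \<beta> x = monomial (\<lambda>i. \<alpha> i + \<beta> i) x"
  by (simp add: monomial_def power_add prod.distrib)

lemma monomial_scaleR: "monomial \<alpha> (t *\<^sub>R x) = of_real t ^ (\<Sum>i\<in>UNIV. \<alpha> i) * monomial \<alpha> x"
  by (simp add: monomial_def power_mult_distrib prod.distrib power_sum)

text \<open>Bilinearity, by one span induction for each factor. This supplies the product case in
  the induction over polynomials.\<close>

lemma span_monomials_mult:
  assumes "f \<in> cfun.span (range monomial)" "g \<in> cfun.span (range monomial)"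
  shows "(\<lambda>x. f x * g x) \<in> cfun.span (range monomial)"
proof -
  have *: "(\<lambda>x. monomial \<alpha> x * g x) \<in> cfun.span (range monomial)" for \<alpha>
    using assms(2)
  proof (induction rule: cfun.span_induct_alt)
    case base
    then show ?case using cfun.span_zero by (simp add: zero_fun_def)
  next
    case (step c b y)
    then obtain \<beta> where b: "b = monomial \<beta>" by auto
    have "(\<lambda>x. monomial \<alpha> x * ((\<lambda>x. c * b x) + y) x) =
        (\<lambda>x. c * monomial (\<lambda>i. \<alpha> i + \<beta> i) x) + (\<lambda>x. monomial \<alpha> x * y x)"
      by (auto simp: fun_eq_iff b monomial_mult[symmetric] algebra_simps)
    moreover have "\<dots> \<in> cfun.span (range monomial)"
      by (intro cfun.span_add cfun.span_scale cfun.span_base rangeI step)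
    ultimately show ?case by simp
  qed
  show ?thesis
    using assms(1)
  proof (induction rule: cfun.span_induct_alt)
    case base
    then show ?case using cfun.span_zero by (simp add: zero_fun_def)
  next
    case (step c b y)
    then obtain \<beta> where b: "b = monomial \<beta>" by auto
    have "(\<lambda>x. ((\<lambda>x. c * b x) + y) x * g x) =
        (\<lambda>x. c * (monomial \<beta> x * g x)) + (\<lambda>x. y x * g x)"
      by (auto simp: fun_eq_iff b algebra_simps)
    moreover have "\<dots> \<in> cfun.span (range monomial)"
      by (intro cfun.span_add cfun.span_scale * step)
    ultimately show ?case by simp
  qed
qed

lemma const_in_span_monomials: "(\<lambda>x. c) \<in> cfun.span (range monomial)"
proof -
  have "(\<lambda>x. c * monomial (\<lambda>_. 0) x) \<in> cfun.span (range monomial)"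
    by (intro cfun.span_scale cfun.span_base rangeI)
  then show ?thesis by (simp add: monomial_def)
qed

lemma real_polynomial_in_span_monomials:
  fixes p :: "real^'n \<Rightarrow> real"
  assumes "real_polynomial_function p"
  shows "(\<lambda>x. complex_of_real (p x)) \<in> cfun.span (range monomial)"
  using assms
proof induction
  case (linear f)
  interpret bounded_linear f by fact
  \<comment> \<open>The exponent vector is the indicator of \<open>i\<close>, so the monomial is a
    coordinate function and \<open>E\<close> expands \<open>f\<close> in the standard basis.\<close>
  have E: "complex_of_real (f x) = (\<Sum>i\<in>UNIV. of_real (f (axis i 1)) * monomial (\<lambda>j. if j = i then 1 else 0) x)" for x
  proof -
    have "f x = f (\<Sum>i\<in>UNIV. x $ i *\<^sub>R axis i 1)"
      by (simp only: basis_expansion scalar_mult_eq_scaleR[symmetric])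
    also have "\<dots> = (\<Sum>i\<in>UNIV. f (axis i 1) * x $ i)"
      by (simp add: sum scaleR mult.commute)
    finally show ?thesis
      by (simp add: monomial_def if_distrib[of "\<lambda>u. _ ^ u"] cong: if_cong)
  qed
  have "(\<lambda>x. complex_of_real (f x)) =
      (\<Sum>i\<in>UNIV. (\<lambda>x. of_real (f (axis i 1)) * monomial (\<lambda>j. if j = i then 1 else 0) x))"
    by (rule ext, unfold sum_fun_apply, rule E)
  moreover have "\<dots> \<in> cfun.span (range monomial)"
    by (intro cfun.span_sum cfun.span_scale cfun.span_base rangeI)
  ultimately show ?case by simp
next
  case (const c)
  show ?case by (rule const_in_span_monomials)
next
  case (add f g)
  have "(\<lambda>x. complex_of_real (f x + g x)) = (\<lambda>x. of_real (f x)) + (\<lambda>x. of_real (g x))"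
    by (auto simp: fun_eq_iff)
  then show ?case using add by (simp only: cfun.span_add)
next
  case (mult f g)
  then show ?case using span_monomials_mult by fastforce
qed

lemma polynomial_function_in_span_monomials:
  fixes p :: "real^'n \<Rightarrow> complex"
  assumes "polynomial_function p"
  shows "p \<in> cfun.span (range monomial)"
proof -
  have "p = (\<lambda>x. of_real (Re (p x))) + (\<lambda>x. \<i> * of_real (Im (p x)))"
    by (auto simp: fun_eq_iff complex_eq_iff)
  moreover have "\<dots> \<in> cfun.span (range monomial)"
    using assms unfolding polynomial_function_complex_iff
    by (intro cfun.span_add cfun.span_scale real_polynomial_in_span_monomials) auto
  ultimately show ?thesis by simp
qed

definition monomials_of_degree :: "nat \<Rightarrow> (real^'n \<Rightarrow> complex) set" where
  "monomials_of_degree m = monomial ` {\<alpha>. sum \<alpha> UNIV = m}"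

lemma span_monomials_of_degree_scaleR:
  assumes "h \<in> cfun.span (monomials_of_degree m)"
  shows "h (t *\<^sub>R x) = of_real t ^ m * h x"
  using assms
  by (induction rule: cfun.span_induct_alt)
     (auto simp: monomials_of_degree_def monomial_scaleR algebra_simps)

text \<open>That the parts vanish above N is recorded so that the range of summation can be enlarged
  when a monomial of higher degree is added.\<close>

lemma span_monomials_homogeneous_parts:
  assumes "p \<in> cfun.span (range monomial)"
  shows "\<exists>q N. (\<forall>m. q m \<in> cfun.span (monomials_of_degree m)) \<and> (\<forall>m>N. q m = 0) \<and> (\<forall>x. p x = (\<Sum>m\<le>N. q m x))"
  using assms
proof (induction rule: cfun.span_induct_alt)
  case base
  show ?case
    by (intro exI[of _ "\<lambda>_. 0"] exI[of _ 0]) (auto simp: cfun.span_zero[unfolded zero_fun_def])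
next
  case (step c b y)
  then obtain q N where q: "\<And>m. q m \<in> cfun.span (monomials_of_degree m)" "\<And>m. m > N \<Longrightarrow> q m = 0"
    "\<And>x. y x = (\<Sum>m\<le>N. q m x)" by blast
  from step obtain \<alpha> where b: "b = monomial \<alpha>" by auto
  define d where "d = sum \<alpha> UNIV"
  define q' where "q' m = (\<lambda>x. (if m = d then c else 0) * b x) + q m" for m
  have "b \<in> monomials_of_degree d" by (auto simp: monomials_of_degree_def b d_def)
  have "q' m \<in> cfun.span (monomials_of_degree m)" for m
  proof -
    have "(\<lambda>x. (if m = d then c else 0) * b x) \<in> cfun.span (monomials_of_degree m)"
      using \<open>b \<in> monomials_of_degree d\<close>
      by (cases "m = d") (simp_all add: cfun.span_scale cfun.span_base cfun.span_zero[unfolded zero_fun_def])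
    then show ?thesis unfolding q'_def by (rule cfun.span_add[OF _ q(1)])
  qed
  moreover have "q' m = 0" if "m > max N d" for m
    using that by (auto simp: q'_def q fun_eq_iff)
  moreover have "((\<lambda>x. c * b x) + y) x = (\<Sum>m\<le>max N d. q' m x)" for x
  proof -
    have "(\<Sum>m\<le>max N d. q m x) = (\<Sum>m\<le>N. q m x)"
      by (rule sum.mono_neutral_right) (auto simp: q(2))
    then show ?thesis
      by (simp add: q'_def q(3) sum.distrib if_distrib[of "\<lambda>u. u * _"] cong: if_cong)
  qed
  ultimately show ?case by blast
qed

text \<open>For fixed x, p(tx) = t^k p(x) and the decomposition of p into homogeneous parts give two
  polynomials in t that agree at all real t, hence have equal coefficients. So p is its own part of
  degree k.\<close>

lemma homogeneous_polynomial_in_span: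
  fixes p :: "real^'n \<Rightarrow> complex"
  assumes p: "polynomial_function p" and hom: "\<And>t x. p (t *\<^sub>R x) = of_real t ^ k * p x"
  shows "p \<in> cfun.span (monomials_of_degree k)"
proof -
  obtain q N where q: "\<And>m. q m \<in> cfun.span (monomials_of_degree m)" "\<And>m. m > N \<Longrightarrow> q m = 0"
    "\<And>x. p x = (\<Sum>m\<le>N. q m x)"
    using span_monomials_homogeneous_parts[OF polynomial_function_in_span_monomials[OF p]] by blast
  have "p x = q k x" for x
  proof -
    define a where "a m = q m x - (if m = k then p x else 0)" for m
    have zero: "(\<Sum>m\<le>max N k. a m * of_real t ^ m) = 0" for t :: real
    proof -
      have "(\<Sum>m\<le>max N k. q m x * of_real t ^ m) = (\<Sum>m\<le>N. q m x * of_real t ^ m)"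
        by (rule sum.mono_neutral_right) (auto simp: q(2))
      also have "\<dots> = p (t *\<^sub>R x)"
        unfolding q(3) by (intro sum.cong refl) (simp add: span_monomials_of_degree_scaleR[OF q(1)])
      finally show ?thesis
        by (simp add: a_def hom left_diff_distrib sum_subtractf if_distrib[of "\<lambda>u. u * _"] cong: if_cong)
    qed
    have "a k = 0"
    proof (rule ccontr)
      assume "a k \<noteq> 0"
      then have "\<exists>m\<le>max N k. a m \<noteq> 0" by (intro exI[of _ k]) auto
      then have "finite {z. (\<Sum>m\<le>max N k. a m * z ^ m) = 0}"
        using polyfun_rootbound[of "max N k" a] by blast
      moreover have "range complex_of_real \<subseteq> {z. (\<Sum>m\<le>max N k. a m * z ^ m) = 0}"
        using zero by auto
      ultimately have "finite (range complex_of_real)" by (rule finite_subset[rotated])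
      then show False
        by (simp add: finite_image_iff inj_of_real infinite_UNIV_char_0)
    qed
    then show ?thesis by (simp add: a_def)
  qed
  then have "p = q k" by (simp add: fun_eq_iff)
  then show ?thesis using q by simp
qed

text \<open>Harmonics of degree k lie in the span of the monomials of degree k, whose exponents are
  between 0 and k. A crude bound, but polynomial in k.\<close>

lemma harmonic_dim_le: "harmonic_dim TYPE('n::finite) k \<le> (k + 1) ^ CARD('n)"
proof -
  let ?A = "{\<alpha> :: 'n \<Rightarrow> nat. sum \<alpha> UNIV = k}" and ?B = "PiE (UNIV :: 'n set) (\<lambda>_. {..k})"
  have "\<alpha> i \<le> k" if "sum \<alpha> UNIV = k" for \<alpha> and i :: 'n
    using member_le_sum[of i UNIV \<alpha>] that by simp
  then have AB: "?A \<subseteq> ?B" by (auto simp: PiE_def)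
  have fB: "finite ?B" by (intro finite_PiE) auto
  have fM: "finite (monomials_of_degree k :: (real^'n \<Rightarrow> complex) set)"
    unfolding monomials_of_degree_def using finite_subset[OF AB fB] by blast
  have "(harmonics k :: (real^'n \<Rightarrow> complex) set) \<subseteq> cfun.span (monomials_of_degree k)"
    by (intro subsetI homogeneous_polynomial_in_span) (auto simp: harmonics_def)
  then have "harmonic_dim TYPE('n) k \<le> card (monomials_of_degree k :: (real^'n \<Rightarrow> complex) set)"
    unfolding harmonic_dim_def using fM by (rule cfun.dim_le_card)
  also have "\<dots> \<le> card ?A"
    unfolding monomials_of_degree_def by (intro card_image_le finite_subset[OF AB fB])
  also have "\<dots> \<le> card ?B" by (intro card_mono fB AB)
  also have "\<dots> = (k + 1) ^ CARD('n)" by (simp add: card_PiE)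
  finally show ?thesis .
qed

section \<open>Orthonormal spherical harmonics and their reproducing kernel\<close>

locale spherical_basis =
  fixes \<sigma> :: "(real^'n) measure"
    and Y :: "nat \<Rightarrow> nat \<Rightarrow> real^'n \<Rightarrow> complex"
  assumes card_ge_2: "CARD('n) \<ge> 2"
    and rotation_invariant: "rotation_invariant_sphere_measure \<sigma>"
    and basis: "spherical_harmonic_basis \<sigma> Y"
begin

lemma sets_\<sigma>: "sets \<sigma> = sets (restrict_space borel (sphere 0 1))"
  using rotation_invariant by (simp add: rotation_invariant_sphere_measure_def)

lemma space_\<sigma>: "space \<sigma> = sphere 0 1"
  using sets_eq_imp_space_eq[OF sets_\<sigma>] by (simp add: space_restrict_space)

sublocale finite_measure \<sigma>
  using rotation_invariant by (simp add: rotation_invariant_sphere_measure_def)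

lemma measure_pos: "measure \<sigma> (space \<sigma>) > 0"
  using rotation_invariant emeasure_eq_measure[of "space \<sigma>"]
  by (auto simp: rotation_invariant_sphere_measure_def zero_less_measure_iff)

lemma continuous_measurable:
  fixes f :: "real^'n \<Rightarrow> complex"
  assumes "continuous_on UNIV f"
  shows "f \<in> borel_measurable \<sigma>"
  unfolding measurable_cong_sets[OF sets_\<sigma> refl]
  by (intro borel_measurable_continuous_on_restrict continuous_on_subset[OF assms]) simp

lemma continuous_integrable:
  fixes f :: "real^'n \<Rightarrow> complex"
  assumes "continuous_on UNIV f"
  shows "integrable \<sigma> f"
proof -
  have "compact (f ` sphere 0 1)"
    by (intro compact_continuous_image continuous_on_subset[OF assms]) auto
  then obtain B where "\<And>x. x \<in> sphere 0 1 \<Longrightarrow> norm (f x) \<le> B"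
    using compact_imp_bounded bounded_iff by (metis image_eqI)
  then show ?thesis
    by (intro integrable_const_bound[of _ B] continuous_measurable assms AE_I2) (auto simp: space_\<sigma>)
qed

lemma Y_harmonics: "l \<in> {1..harmonic_dim TYPE('n) k} \<Longrightarrow> Y k l \<in> harmonics k"
  using basis unfolding spherical_harmonic_basis_def by blast

lemma Y_scaleR: "l \<in> {1..harmonic_dim TYPE('n) k} \<Longrightarrow> Y k l (t *\<^sub>R x) = of_real t ^ k * Y k l x"
  using harmonicsD(2)[OF Y_harmonics] .

lemma harmonics_combination: "(\<lambda>x. \<Sum>l=1..harmonic_dim TYPE('n) k. u l * Y k l x) \<in> harmonics k"
  (is "?h \<in> _")
proof -
  have "polynomial_function ?h"
    by (intro polynomial_function_sum_times harmonicsD(1)[OF Y_harmonics]) auto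
  moreover have "laplacian ?h = (\<lambda>x. 0)"
    by (subst laplacian_sum) (auto simp: harmonicsD[OF Y_harmonics])
  ultimately show ?thesis
    by (auto simp: harmonics_def Y_scaleR sum_distrib_left mult_ac intro!: sum.cong)
qed

lemma Y_orthonormal:
  "l \<in> {1..harmonic_dim TYPE('n) k} \<Longrightarrow> m \<in> {1..harmonic_dim TYPE('n) k} \<Longrightarrow> (LINT \<theta>|\<sigma>. Y k l \<theta> * cnj (Y k m \<theta>)) = (if l = m then 1 else 0)"
  using basis unfolding spherical_harmonic_basis_def by blast

lemma harmonics_continuous: "h \<in> harmonics k \<Longrightarrow> continuous_on S h"
  by (intro continuous_on_polymonial_function harmonicsD)

lemma harmonics_expansion:
  assumes "h \<in> harmonics k"
  obtains u where "\<And>x. h x = (\<Sum>l=1..harmonic_dim TYPE('n) k. u l * Y k l x)"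
proof -
  have "h \<in> cfun.span (Y k ` {1..harmonic_dim TYPE('n) k})"
    using basis assms by (auto simp: spherical_harmonic_basis_def)
  then have "\<exists>u. \<forall>x. h x = (\<Sum>l=1..harmonic_dim TYPE('n) k. u l * Y k l x)"
  proof (induction rule: cfun.span_induct_alt)
    case base
    show ?case by (intro exI[of _ "\<lambda>_. 0"]) auto
  next
    case (step c b y)
    then obtain u m where u: "\<And>x. y x = (\<Sum>l=1..harmonic_dim TYPE('n) k. u l * Y k l x)" and m: "m \<in> {1..harmonic_dim TYPE('n) k}" "b = Y k m"
      by auto
    show ?case
      using m by (intro exI[of _ "\<lambda>l. (if l = m then c else 0) + u l"])
        (auto simp: u distrib_right sum.distrib if_distrib[of "\<lambda>u. u * _"] cong: if_cong)
  qed
  then show ?thesis using that by blast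
qed

lemma parseval_sphere:
  "(LINT \<theta>|\<sigma>. (\<Sum>l=1..harmonic_dim TYPE('n) k. u l * Y k l \<theta>) * cnj (\<Sum>l=1..harmonic_dim TYPE('n) k. u l * Y k l \<theta>)) =
    of_real (\<Sum>l=1..harmonic_dim TYPE('n) k. (cmod (u l))\<^sup>2)"
proof -
  have int: "integrable \<sigma> (\<lambda>\<theta>. Y k l \<theta> * cnj (Y k m \<theta>))" if "l \<in> {1..harmonic_dim TYPE('n) k}" "m \<in> {1..harmonic_dim TYPE('n) k}" for l m
    by (intro continuous_integrable continuous_intros harmonics_continuous[OF Y_harmonics] that)
  have "(LINT \<theta>|\<sigma>. (\<Sum>l=1..harmonic_dim TYPE('n) k. u l * Y k l \<theta>) * cnj (\<Sum>l=1..harmonic_dim TYPE('n) k. u l * Y k l \<theta>)) =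
      (LINT \<theta>|\<sigma>. (\<Sum>l=1..harmonic_dim TYPE('n) k. \<Sum>m=1..harmonic_dim TYPE('n) k. u l * cnj (u m) * (Y k l \<theta> * cnj (Y k m \<theta>))))"
    by (simp only: cnj_sum sum_product complex_cnj_mult mult_ac)
  also have "\<dots> = (\<Sum>l=1..harmonic_dim TYPE('n) k. \<Sum>m=1..harmonic_dim TYPE('n) k. u l * cnj (u m) * (if l = m then 1 else 0))"
    by (simp only: Bochner_Integration.integral_sum Bochner_Integration.integrable_sum
        integrable_mult_right int integral_mult_right_zero Y_orthonormal cong: sum.cong)
  also have "\<dots> = of_real (\<Sum>l=1..harmonic_dim TYPE('n) k. (cmod (u l))\<^sup>2)"
    by (simp add: complex_norm_square if_distrib[of "\<lambda>u. _ * u"] cong: if_cong del: of_real_power)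
  finally show ?thesis .
qed

text \<open>Vanishing on the sphere suffices because \<sigma> lives there: the integral of the
  squared modulus is 0, and by \<open>parseval_sphere\<close> it is the sum of the |u_l|^2.\<close>

lemma Y_independent:
  assumes "\<And>\<theta>. \<theta> \<in> sphere 0 1 \<Longrightarrow> (\<Sum>l=1..harmonic_dim TYPE('n) k. u l * Y k l \<theta>) = 0" "l \<in> {1..harmonic_dim TYPE('n) k}"
  shows "u l = 0"
proof -
  have "(LINT \<theta>|\<sigma>. (\<Sum>l=1..harmonic_dim TYPE('n) k. u l * Y k l \<theta>) * cnj (\<Sum>l=1..harmonic_dim TYPE('n) k. u l * Y k l \<theta>)) = (LINT \<theta>|\<sigma>. 0)"
    by (intro Bochner_Integration.integral_cong refl) (simp only: assms(1) space_\<sigma> mult_zero_left)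
  then have "(\<Sum>l=1..harmonic_dim TYPE('n) k. (cmod (u l))\<^sup>2) = 0"
    unfolding parseval_sphere by (simp del: of_real_sum)
  then show ?thesis using assms(2)
    by (subst (asm) sum_nonneg_eq_0_iff) auto
qed

text \<open>The diagonal of the reproducing kernel of \<open>harmonics k\<close> in
  L^2(\<sigma>).\<close>

definition kernel :: "nat \<Rightarrow> real^'n \<Rightarrow> real" where
  "kernel k \<theta> = (\<Sum>l=1..harmonic_dim TYPE('n) k. (cmod (Y k l \<theta>))\<^sup>2)"

lemma integral_rotation:
  fixes f :: "real^'n \<Rightarrow> complex"
  assumes A: "rotation_matrix A" and f: "continuous_on UNIV f"
  shows "(LINT \<theta>|\<sigma>. f (A *v \<theta>)) = (LINT \<theta>|\<sigma>. f \<theta>)"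
proof -
  have norm: "norm (A *v x) = norm x" for x
    using A orthogonal_transformation_norm[of "(*v) A"]
    by (simp add: rotation_matrix_def orthogonal_transformation_matrix)
  have "(*v) A \<in> measurable (restrict_space borel (sphere 0 1)) (restrict_space borel (sphere 0 1))"
    by (intro measurable_restrict_space2 borel_measurable_continuous_on_restrict
        linear_continuous_on linear_conv_bounded_linear[THEN iffD1] matrix_vector_mul_linear)
       (auto simp: space_restrict_space norm)
  then have "(*v) A \<in> measurable \<sigma> \<sigma>"
    by (simp add: measurable_cong_sets[OF sets_\<sigma> sets_\<sigma>])
  from integral_distr[OF this continuous_measurable[OF f]]
  show ?thesis using A rotation_invariant
    by (simp add: rotation_invariant_sphere_measure_def)
qed

text \<open>\<open>kernel k \<theta>\<close> is the largest value of \<open>\<bar>h \<theta>\<bar>\<^sup>2\<close> over harmonics \<open>h\<close> of norm one, a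
  rotation invariant quantity.\<close>

lemma kernel_le:
  assumes "\<theta> \<in> sphere 0 1" "\<theta>' \<in> sphere 0 1"
  shows "kernel k \<theta> \<le> kernel k \<theta>'"
proof -
  obtain f where f: "orthogonal_transformation f" "det (matrix f) = 1" "f \<theta>' = \<theta>"
    using rotation_exists_1[OF card_ge_2, of \<theta>' \<theta>] assms by auto
  define A where "A = matrix f"
  have A: "rotation_matrix A" "A *v \<theta>' = \<theta>"
    using f by (auto simp: A_def rotation_matrix_def orthogonal_transformation_matrix matrix_works orthogonal_transformation)
  \<comment> \<open>The reproducing kernel with pole \<theta>: its value at the pole and its squared
    norm both equal \<open>kernel k \<theta>\<close>. The rotation moves the pole to
    \<theta>'.\<close>
  define h where "h x = (\<Sum>l=1..harmonic_dim TYPE('n) k. cnj (Y k l \<theta>) * Y k l x)" for x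
  have h\<theta>: "h \<theta> = of_real (kernel k \<theta>)"
    by (simp add: h_def kernel_def complex_norm_square mult.commute del: of_real_power)
  have "h \<in> harmonics k"
    unfolding h_def by (rule harmonics_combination)
  then have "(\<lambda>x. h (A *v x)) \<in> harmonics k"
    using A harmonics_rotation by (auto simp: rotation_matrix_def)
  then obtain u where u: "\<And>x. h (A *v x) = (\<Sum>l=1..harmonic_dim TYPE('n) k. u l * Y k l x)"
    using harmonics_expansion by metis
  have "complex_of_real (\<Sum>l=1..harmonic_dim TYPE('n) k. (cmod (u l))\<^sup>2) = (LINT \<theta>|\<sigma>. h (A *v \<theta>) * cnj (h (A *v \<theta>)))"
    unfolding u parseval_sphere ..
  also have "\<dots> = (LINT \<theta>|\<sigma>. h \<theta> * cnj (h \<theta>))"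
    by (intro integral_rotation[of A "\<lambda>x. h x * cnj (h x)"] A continuous_intros harmonics_continuous[OF \<open>h \<in> harmonics k\<close>])
  also have "\<dots> = complex_of_real (kernel k \<theta>)"
    unfolding h_def parseval_sphere kernel_def by simp
  finally have norm_u: "(\<Sum>l=1..harmonic_dim TYPE('n) k. (cmod (u l))\<^sup>2) = kernel k \<theta>"
    using of_real_eq_iff by blast
  have "kernel k \<theta> \<ge> 0" "kernel k \<theta>' \<ge> 0" by (auto simp: kernel_def sum_nonneg)
  have "kernel k \<theta> = cmod (h (A *v \<theta>'))"
    using A h\<theta> \<open>kernel k \<theta> \<ge> 0\<close> by simp
  also have "\<dots> \<le> (\<Sum>l=1..harmonic_dim TYPE('n) k. cmod (u l) * cmod (Y k l \<theta>'))"
    unfolding u by (intro sum_norm_le) (simp add: norm_mult)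
  finally have "(kernel k \<theta>)\<^sup>2 \<le> (\<Sum>l=1..harmonic_dim TYPE('n) k. cmod (u l) * cmod (Y k l \<theta>'))\<^sup>2"
    using \<open>kernel k \<theta> \<ge> 0\<close> by (intro power_mono)
  also have "\<dots> \<le> kernel k \<theta> * kernel k \<theta>'"
    using Cauchy_Schwarz_ineq_sum[of "\<lambda>l. cmod (u l)" "\<lambda>l. cmod (Y k l \<theta>')" "{1..harmonic_dim TYPE('n) k}"]
    unfolding norm_u kernel_def[symmetric] .
  finally have "kernel k \<theta> * kernel k \<theta> \<le> kernel k \<theta> * kernel k \<theta>'"
    by (simp add: power2_eq_square)
  \<comment> \<open>One factor is cancelled; if it is 0, the claim is just nonnegativity.\<close>
  then show ?thesis
    using \<open>kernel k \<theta> \<ge> 0\<close> \<open>kernel k \<theta>' \<ge> 0\<close> by (cases "kernel k \<theta> = 0") auto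
qed

text \<open>Integrate \<open>kernel_le\<close> over its second point: the left side becomes the
  value times the total mass, the right side the dimension, by orthonormality. Hence the constant is
  the inverse of the total mass.\<close>

lemma kernel_bound:
  obtains C where "C \<ge> 0" "\<And>k \<theta>. \<theta> \<in> sphere 0 1 \<Longrightarrow> kernel k \<theta> \<le> C * (real k + 1) ^ CARD('n)"
proof
  let ?s = "measure \<sigma> (space \<sigma>)"
  show "1 / ?s \<ge> 0" using measure_pos by simp
  fix k \<theta> assume \<theta>: "\<theta> \<in> sphere (0::real^'n) 1"
  have int: "integrable \<sigma> (\<lambda>\<theta>. Y k l \<theta> * cnj (Y k l \<theta>))" if "l \<in> {1..harmonic_dim TYPE('n) k}" for l
    by (intro continuous_integrable continuous_intros harmonics_continuous[OF Y_harmonics] that)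
  have kc: "complex_of_real (kernel k \<theta>) = (\<Sum>l=1..harmonic_dim TYPE('n) k. Y k l \<theta> * cnj (Y k l \<theta>))" for \<theta>
    by (simp add: kernel_def complex_norm_square del: of_real_power)
  have intc: "integrable \<sigma> (\<lambda>\<theta>. complex_of_real (kernel k \<theta>))"
    unfolding kc by (intro Bochner_Integration.integrable_sum int)
  have "complex_of_real (LINT \<theta>|\<sigma>. kernel k \<theta>) = (LINT \<theta>|\<sigma>. complex_of_real (kernel k \<theta>))"
    by simp
  also have "\<dots> = of_nat (harmonic_dim TYPE('n) k)"
    unfolding kc using int by (simp add: Y_orthonormal)
  finally have *: "(LINT \<theta>|\<sigma>. kernel k \<theta>) = real (harmonic_dim TYPE('n) k)"
    by (metis of_real_eq_iff of_real_of_nat_eq)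
  have "kernel k \<theta> * ?s = (LINT \<theta>'|\<sigma>. kernel k \<theta>)" by (simp add: mult.commute)
  also have "\<dots> \<le> (LINT \<theta>|\<sigma>. kernel k \<theta>)"
    using complex_of_real_integrable_eq[THEN iffD1, OF intc] kernel_le[OF \<theta>] by (intro integral_mono) (auto simp: space_\<sigma>)
  also have "\<dots> \<le> (real k + 1) ^ CARD('n)"
    unfolding * using harmonic_dim_le[where 'n='n, of k]
    by (metis of_nat_1 of_nat_add of_nat_le_iff of_nat_power)
  finally show "kernel k \<theta> \<le> 1 / ?s * (real k + 1) ^ CARD('n)"
    using measure_pos by (simp add: field_simps)
qed

end

section \<open>Square summable families\<close>

text \<open>Unordered summation, so that index triples need neither an enumeration nor an
  order.\<close>

definition l2_summable_on :: "('i \<Rightarrow> complex) \<Rightarrow> 'i set \<Rightarrow> bool" where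
  "l2_summable_on u S \<longleftrightarrow> (\<lambda>i. (cmod (u i))\<^sup>2) summable_on S"

definition l2_norm_on :: "('i \<Rightarrow> complex) \<Rightarrow> 'i set \<Rightarrow> real" where
  "l2_norm_on u S = sqrt (\<Sum>\<^sub>\<infinity>i\<in>S. (cmod (u i))\<^sup>2)"

lemma l2_norm_on_nonneg: "0 \<le> l2_norm_on u S"
  by (simp add: l2_norm_on_def infsum_nonneg)

lemma l2_norm_on_power2: "(l2_norm_on u S)\<^sup>2 = (\<Sum>\<^sub>\<infinity>i\<in>S. (cmod (u i))\<^sup>2)"
  by (simp add: l2_norm_on_def infsum_nonneg)

lemma l2_norm_on_cong: "(\<And>i. i \<in> S \<Longrightarrow> cmod (u i) = cmod (v i)) \<Longrightarrow> l2_norm_on u S = l2_norm_on v S"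
  by (auto simp: l2_norm_on_def cong: infsum_cong)

lemma L2_set_le_l2_norm_on:
  assumes "l2_summable_on u S" "finite F" "F \<subseteq> S"
  shows "L2_set (\<lambda>i. cmod (u i)) F \<le> l2_norm_on u S"
  unfolding L2_set_def l2_norm_on_def
  using assms by (intro real_sqrt_le_mono finite_sum_le_infsum) (auto simp: l2_summable_on_def)

lemma norm_le_l2_norm_on: "l2_summable_on u S \<Longrightarrow> i \<in> S \<Longrightarrow> cmod (u i) \<le> l2_norm_on u S"
  using L2_set_le_l2_norm_on[of u S "{i}"] by (simp add: L2_set_def)

text \<open>Reduces claims about l2 to finite subsets, where Minkowski's inequality and limits of
  \<open>L2_set\<close> apply.\<close>

lemma l2_on_leI:
  assumes "\<And>F. finite F \<Longrightarrow> F \<subseteq> S \<Longrightarrow> L2_set (\<lambda>i. cmod (u i)) F \<le> B" "0 \<le> B"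
  shows "l2_summable_on u S" and "l2_norm_on u S \<le> B"
proof -
  have le: "(\<Sum>i\<in>F. (cmod (u i))\<^sup>2) \<le> B\<^sup>2" if "finite F" "F \<subseteq> S" for F
    using assms(1)[OF that] unfolding L2_set_def by (rule sqrt_le_D)
  show s: "l2_summable_on u S"
    unfolding l2_summable_on_def
    by (rule nonneg_bdd_above_summable_on) (auto intro!: bdd_aboveI2 le)
  have "(\<Sum>\<^sub>\<infinity>i\<in>S. (cmod (u i))\<^sup>2) \<le> B\<^sup>2"
    using s le unfolding l2_summable_on_def by (intro infsum_le_finite_sums)
  then show "l2_norm_on u S \<le> B"
    using \<open>0 \<le> B\<close> unfolding l2_norm_on_def by (intro real_le_lsqrt) auto
qed

lemma l2_on_diff:
  assumes "l2_summable_on u S" "l2_summable_on v S"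
  shows "l2_summable_on (\<lambda>i. u i - v i) S"
    and "l2_norm_on (\<lambda>i. u i - v i) S \<le> l2_norm_on u S + l2_norm_on v S"
proof -
  have "L2_set (\<lambda>i. cmod (u i - v i)) F \<le> l2_norm_on u S + l2_norm_on v S" if "finite F" "F \<subseteq> S" for F
  proof -
    have "L2_set (\<lambda>i. cmod (u i - v i)) F \<le> L2_set (\<lambda>i. cmod (u i) + cmod (v i)) F"
      by (intro L2_set_mono norm_triangle_ineq4) auto
    also have "\<dots> \<le> L2_set (\<lambda>i. cmod (u i)) F + L2_set (\<lambda>i. cmod (v i)) F"
      by (rule L2_set_triangle_ineq)
    also have "\<dots> \<le> l2_norm_on u S + l2_norm_on v S"
      by (intro add_mono L2_set_le_l2_norm_on assms that)
    finally show ?thesis .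
  qed
  then show "l2_summable_on (\<lambda>i. u i - v i) S"
    "l2_norm_on (\<lambda>i. u i - v i) S \<le> l2_norm_on u S + l2_norm_on v S"
    using l2_norm_on_nonneg[of u S] l2_norm_on_nonneg[of v S]
    by (auto intro: l2_on_leI[where B = "l2_norm_on u S + l2_norm_on v S"])
qed

text \<open>The limit is taken coordinatewise; the Cauchy estimate restricted to a finite set passes
  to the limit, and \<open>l2_on_leI\<close> extends it to all of \<open>S\<close>.\<close>

lemma l2_on_complete:
  fixes u :: "nat \<Rightarrow> 'i \<Rightarrow> complex"
  assumes u: "\<And>n. l2_summable_on (u n) S"
    and Cauchy: "\<And>e. e > 0 \<Longrightarrow> \<exists>M. \<forall>m\<ge>M. \<forall>n\<ge>M. l2_norm_on (\<lambda>i. u m i - u n i) S < e"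
  obtains v where "l2_summable_on v S" "(\<lambda>n. l2_norm_on (\<lambda>i. u n i - v i) S) \<longlonglongrightarrow> 0"
proof -
  have "convergent (\<lambda>n. u n i)" if "i \<in> S" for i
    unfolding Cauchy_convergent_iff[symmetric]
  proof (rule metric_CauchyI)
    fix e :: real assume "e > 0"
    from Cauchy[OF this] obtain M where M: "\<And>m n. m \<ge> M \<Longrightarrow> n \<ge> M \<Longrightarrow> l2_norm_on (\<lambda>i. u m i - u n i) S < e"
      by blast
    have "dist (u m i) (u n i) < e" if "m \<ge> M" "n \<ge> M" for m n
      using norm_le_l2_norm_on[OF l2_on_diff(1)[OF u u] \<open>i \<in> S\<close>, of m n] M[OF that]
      by (simp add: dist_norm)
    then show "\<exists>M. \<forall>m\<ge>M. \<forall>n\<ge>M. dist (u m i) (u n i) < e" by blast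
  qed
  then have "\<exists>v. \<forall>i\<in>S. (\<lambda>n. u n i) \<longlonglongrightarrow> v i"
    unfolding convergent_def by metis
  then obtain v where v: "\<And>i. i \<in> S \<Longrightarrow> (\<lambda>n. u n i) \<longlonglongrightarrow> v i" by blast
  \<comment> \<open>Only a weak inequality survives the limit, which is why e / 2 is used
    below.\<close>
  have bound: "l2_summable_on (\<lambda>i. u n i - v i) S \<and> l2_norm_on (\<lambda>i. u n i - v i) S \<le> e"
    if e: "e > 0" and M: "\<And>m. m \<ge> M \<Longrightarrow> l2_norm_on (\<lambda>i. u n i - u m i) S < e" for e n M
  proof -
    have "L2_set (\<lambda>i. cmod (u n i - v i)) F \<le> e" if F: "finite F" "F \<subseteq> S" for F
    proof (rule tendsto_upperbound)
      show "(\<lambda>m. L2_set (\<lambda>i. cmod (u n i - u m i)) F) \<longlonglongrightarrow> L2_set (\<lambda>i. cmod (u n i - v i)) F"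
        unfolding L2_set_def using F by (intro tendsto_intros v) auto
      have "L2_set (\<lambda>i. cmod (u n i - u m i)) F \<le> e" if "m \<ge> M" for m
        using L2_set_le_l2_norm_on[OF l2_on_diff(1)[OF u u] F, of n m] M[OF that] by simp
      then show "\<forall>\<^sub>F m in sequentially. L2_set (\<lambda>i. cmod (u n i - u m i)) F \<le> e"
        by (auto simp: eventually_sequentially)
    qed simp
    then show ?thesis using l2_on_leI[of S "\<lambda>i. u n i - v i" e] e by auto
  qed
  obtain M where "\<And>m n. m \<ge> M \<Longrightarrow> n \<ge> M \<Longrightarrow> l2_norm_on (\<lambda>i. u m i - u n i) S < 1"
    using Cauchy[of 1] by auto
  then have "l2_summable_on (\<lambda>i. u M i - v i) S"
    using bound[of 1 M M] by simp
  \<comment> \<open>Here \<open>v\<close> is recovered as the difference of \<open>u M\<close> and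
    \<open>u M - v\<close>.\<close>
  from l2_on_diff(1)[OF u[of M] this] have "l2_summable_on v S" by simp
  moreover have "(\<lambda>n. l2_norm_on (\<lambda>i. u n i - v i) S) \<longlonglongrightarrow> 0"
  proof (rule metric_LIMSEQ_I)
    fix e :: real assume "e > 0"
    obtain M where M: "\<And>m n. m \<ge> M \<Longrightarrow> n \<ge> M \<Longrightarrow> l2_norm_on (\<lambda>i. u m i - u n i) S < e / 2"
      using Cauchy[of "e / 2"] \<open>e > 0\<close> by auto
    have "dist (l2_norm_on (\<lambda>i. u n i - v i) S) 0 < e" if "n \<ge> M" for n
      using bound[of "e / 2" M n] M[OF that] \<open>e > 0\<close> l2_norm_on_nonneg[of "\<lambda>i. u n i - v i" S]
      by (auto simp: dist_norm)
    then show "\<exists>M. \<forall>n\<ge>M. dist (l2_norm_on (\<lambda>i. u n i - v i) S) 0 < e" by blast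
  qed
  ultimately show ?thesis using that by blast
qed

text \<open>The squared error is the sum over \<open>S - A n\<close>, that is the total minus a
  finite sum, and the total is the limit of finite sums along the filter.\<close>

lemma l2_on_truncation:
  assumes u: "l2_summable_on u S"
    and A: "filterlim A (finite_subsets_at_top S) sequentially"
    and A': "\<And>n. finite (A n)" "\<And>n. A n \<subseteq> S"
  shows "l2_summable_on (\<lambda>i. if i \<in> A n then u i else 0) S"
    and "(\<lambda>n. l2_norm_on (\<lambda>i. (if i \<in> A n then u i else 0) - u i) S) \<longlonglongrightarrow> 0"
proof -
  let ?f = "\<lambda>i. (cmod (u i))\<^sup>2"
  have f: "?f summable_on S" using u by (simp add: l2_summable_on_def)
  have "(\<lambda>i. (cmod (if i \<in> A n then u i else 0))\<^sup>2) summable_on S \<longleftrightarrow> ?f summable_on A n"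
    using A' by (intro summable_on_cong_neutral) auto
  then show "l2_summable_on (\<lambda>i. if i \<in> A n then u i else 0) S"
    using A' by (simp add: l2_summable_on_def)
  have eq: "l2_norm_on (\<lambda>i. (if i \<in> A n then u i else 0) - u i) S = sqrt (infsum ?f S - sum ?f (A n))" for n
  proof -
    have "infsum (\<lambda>i. (cmod ((if i \<in> A n then u i else 0) - u i))\<^sup>2) S = infsum ?f (S - A n)"
      by (rule infsum_cong_neutral) auto
    moreover have "infsum ?f ((S - A n) \<union> A n) = infsum ?f (S - A n) + infsum ?f (A n)"
      using A' by (intro infsum_Un_disjoint summable_on_subset_banach[OF f]) auto
    moreover have "(S - A n) \<union> A n = S" using A' by auto
    ultimately show ?thesis using A' by (simp add: l2_norm_on_def)
  qed
  have "(\<lambda>n. sqrt (infsum ?f S - sum ?f (A n))) \<longlonglongrightarrow> sqrt (infsum ?f S - infsum ?f S)"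
    by (intro tendsto_intros filterlim_compose[OF infsum_tendsto[OF f] A])
  then show "(\<lambda>n. l2_norm_on (\<lambda>i. (if i \<in> A n then u i else 0) - u i) S) \<longlonglongrightarrow> 0"
    by (simp add: eq)
qed

section \<open>Unordered and iterated sums over triples\<close>

text \<open>Fubini: absolute summability yields the iterated sum in the order of
  \<open>power_expansion\<close>, with j innermost and k outermost.\<close>

lemma abs_summable_triple:
  fixes g :: "nat \<Rightarrow> nat \<Rightarrow> nat \<Rightarrow> 'a::banach"
  assumes "(\<lambda>(k, l, j). norm (g k l j)) summable_on (SIGMA k:UNIV. {1..d k} \<times> UNIV)"
  shows "l \<in> {1..d k} \<Longrightarrow> summable (\<lambda>j. norm (g k l j))"
    and "(\<lambda>k. \<Sum>l=1..d k. \<Sum>j. g k l j) sums (\<Sum>\<^sub>\<infinity>(k, l, j)\<in>(SIGMA k:UNIV. {1..d k} \<times> UNIV). g k l j)"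
proof -
  let ?G = "\<lambda>(k, l, j). g k l j"
  have G: "(\<lambda>p. norm (?G p)) summable_on (SIGMA k:UNIV. {1..d k} \<times> UNIV)"
    using assms by (simp add: case_prod_unfold)
  then have Gk: "(\<lambda>p. norm (case p of (l, j) \<Rightarrow> g k l j)) summable_on ({1..d k} \<times> UNIV)" for k
    unfolding Infinite_Sum.abs_summable_on_Sigma_iff by (auto simp: case_prod_unfold)
  then have Gl: "(\<lambda>j. norm (g k l j)) summable_on UNIV" if "l \<in> {1..d k}" for k l
    using that unfolding Infinite_Sum.abs_summable_on_Sigma_iff by auto
  then show "l \<in> {1..d k} \<Longrightarrow> summable (\<lambda>j. norm (g k l j))"
    by (auto intro: summable_on_imp_summable)
  have inner: "infsum (\<lambda>(l, j). g k l j) ({1..d k} \<times> UNIV) = (\<Sum>l=1..d k. \<Sum>j. g k l j)" for k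
  proof -
    have "infsum (\<lambda>(l, j). g k l j) ({1..d k} \<times> UNIV) = (\<Sum>l=1..d k. infsum (g k l) UNIV)"
      using infsum_Sigma'_banach[OF Infinite_Sum.abs_summable_summable[OF Gk]] by simp
    also have "\<dots> = (\<Sum>l=1..d k. \<Sum>j. g k l j)"
      using has_sum_imp_sums[OF has_sum_infsum[OF Infinite_Sum.abs_summable_summable[OF Gl]]]
      by (intro sum.cong refl) (auto simp: sums_iff)
    finally show ?thesis .
  qed
  have G': "(\<lambda>(k, p). (case p of (l, j) \<Rightarrow> g k l j)) summable_on (SIGMA k:UNIV. {1..d k} \<times> UNIV)"
    using Infinite_Sum.abs_summable_summable[OF G] by (simp add: case_prod_unfold)
  have "((\<lambda>k. infsum (\<lambda>p. case p of (l, j) \<Rightarrow> g k l j) ({1..d k} \<times> UNIV)) has_sum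
      infsum ?G (SIGMA k:UNIV. {1..d k} \<times> UNIV)) UNIV"
    using infsum_Sigma'_banach[OF G'] summable_on_Sigma_banach[OF G']
    by (simp add: has_sum_iff)
  then show "(\<lambda>k. \<Sum>l=1..d k. \<Sum>j. g k l j) sums (\<Sum>\<^sub>\<infinity>(k, l, j)\<in>(SIGMA k:UNIV. {1..d k} \<times> UNIV). g k l j)"
    unfolding inner by (rule has_sum_imp_sums)
qed

text \<open>Tonelli, as a converse: for nonnegative terms, finiteness of the iterated sums already
  gives unordered summability.\<close>

lemma nonneg_summable_triple:
  fixes g :: "nat \<Rightarrow> nat \<Rightarrow> nat \<Rightarrow> real"
  assumes nn: "\<And>k l j. 0 \<le> g k l j"
    and s1: "\<And>k l. l \<in> {1..d k} \<Longrightarrow> summable (g k l)"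
    and s2: "summable (\<lambda>k. \<Sum>l=1..d k. \<Sum>j. g k l j)"
  shows "(\<lambda>(k, l, j). g k l j) summable_on (SIGMA k:UNIV. {1..d k} \<times> UNIV)"
proof -
  have Gl: "g k l summable_on UNIV" if "l \<in> {1..d k}" for k l
    using s1[OF that] nn by (simp add: summable_on_UNIV_nonneg_real_iff)
  then have Gk: "(\<lambda>p. norm (case p of (l, j) \<Rightarrow> g k l j)) summable_on ({1..d k} \<times> UNIV)" for k
    unfolding Infinite_Sum.abs_summable_on_Sigma_iff by (auto simp: nn)
  have inner: "infsum (\<lambda>(l, j). g k l j) ({1..d k} \<times> UNIV) = (\<Sum>l=1..d k. \<Sum>j. g k l j)" for k
  proof -
    have "infsum (\<lambda>(l, j). g k l j) ({1..d k} \<times> UNIV) = (\<Sum>l=1..d k. infsum (g k l) UNIV)"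
      using infsum_Sigma'_banach[OF Infinite_Sum.abs_summable_summable[OF Gk]] by simp
    also have "\<dots> = (\<Sum>l=1..d k. \<Sum>j. g k l j)"
      using has_sum_imp_sums[OF has_sum_infsum[OF Gl]]
      by (intro sum.cong refl) (auto simp: sums_iff)
    finally show ?thesis .
  qed
  have "(\<lambda>k. infsum (\<lambda>(l, j). g k l j) ({1..d k} \<times> UNIV)) summable_on UNIV"
    unfolding inner using s2 nn s1
    by (subst summable_on_UNIV_nonneg_real_iff) (auto intro!: sum_nonneg suminf_nonneg)
  then have "(\<lambda>p. norm (case p of (k, l, j) \<Rightarrow> g k l j)) summable_on (SIGMA k:UNIV. {1..d k} \<times> UNIV)"
    unfolding Infinite_Sum.abs_summable_on_Sigma_iff using Gk
    by (auto simp: nn case_prod_unfold infsum_nonneg intro!: Gl)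
  then show ?thesis by (rule Infinite_Sum.abs_summable_summable)
qed

lemma summable_polynomial_times_power:
  fixes x :: real
  assumes "0 \<le> x" "x < 1"
  shows "summable (\<lambda>k. (real k + 1) ^ n * x ^ k)"
proof (cases "x = 0")
  \<comment> \<open>Quotients of consecutive terms degenerate for x = 0; there only the term k = 0
    is nonzero.\<close>
  case True
  then show ?thesis
    by (intro summable_finite[of "{0}"]) auto
next
  case False
  have lim: "(\<lambda>k. norm ((real (Suc k) + 1) ^ n * x ^ Suc k) / norm ((real k + 1) ^ n * x ^ k)) \<longlonglongrightarrow> x"
  proof -
    have "(\<lambda>k. (1 + inverse (real (Suc k))) ^ n * x) \<longlonglongrightarrow> (1 + 0) ^ n * x"
      by (intro tendsto_intros LIMSEQ_inverse_real_of_nat)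
    moreover have "norm ((real (Suc k) + 1) ^ n * x ^ Suc k) / norm ((real k + 1) ^ n * x ^ k) =
        (1 + inverse (real (Suc k))) ^ n * x" for k
    proof -
      have "1 + inverse (real (Suc k)) = (real (Suc k) + 1) / (real k + 1)"
        by (simp add: field_simps)
      then show ?thesis
        using assms False by (simp add: power_divide)
    qed
    ultimately show ?thesis by simp
  qed
  obtain c where c: "x < c" "c < 1" using assms dense by blast
  then have "eventually (\<lambda>k. norm ((real (Suc k) + 1) ^ n * x ^ Suc k) / norm ((real k + 1) ^ n * x ^ k) < c) sequentially"
    using order_tendstoD(2)[OF lim] by blast
  then obtain N where N: "\<And>k. k \<ge> N \<Longrightarrow>
      norm ((real (Suc k) + 1) ^ n * x ^ Suc k) / norm ((real k + 1) ^ n * x ^ k) < c"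
    by (auto simp: eventually_sequentially)
  show ?thesis
  proof (rule summable_ratio_test[OF c(2)])
    fix k assume "k \<ge> N"
    have "norm ((real k + 1) ^ n * x ^ k) > 0" using assms False by simp
    with N[OF \<open>k \<ge> N\<close>] show "norm ((real (Suc k) + 1) ^ n * x ^ Suc k) \<le> c * norm ((real k + 1) ^ n * x ^ k)"
      by (simp only: pos_divide_less_eq less_imp_le)
  qed
qed

section \<open>The polyharmonic Hardy space as a sequence space\<close>

definition coeff_index :: "'n::finite itself \<Rightarrow> (nat \<times> nat \<times> nat) set" where
  "coeff_index T = (SIGMA k:UNIV. {1..harmonic_dim T k} \<times> UNIV)"

definition coeff_family :: "(nat \<Rightarrow> nat \<Rightarrow> nat \<Rightarrow> complex) \<Rightarrow> nat \<times> nat \<times> nat \<Rightarrow> complex" where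
  "coeff_family c = (\<lambda>(k, l, j). c k l j)"

lemma coeff_family_apply [simp]: "coeff_family c (k, l, j) = c k l j"
  by (simp add: coeff_family_def)

lemma coeff_index_iff [simp]: "(k, l, j) \<in> coeff_index T \<longleftrightarrow> l \<in> {1..harmonic_dim T k}"
  by (auto simp: coeff_index_def)

text \<open>Makes the l2 results available for the iterated sums of the definition: Tonelli in one
  direction, Fubini in the other.\<close>

lemma square_summable_coeffs_iff:
  "square_summable_coeffs T c \<longleftrightarrow> l2_summable_on (coeff_family c) (coeff_index T)"
proof -
  have eq: "(\<lambda>p. (cmod (coeff_family c p))\<^sup>2) = (\<lambda>(k, l, j). norm ((cmod (c k l j))\<^sup>2))"
    by (auto simp: coeff_family_def)
  show ?thesis
  proof
    assume "square_summable_coeffs T c"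
    then show "l2_summable_on (coeff_family c) (coeff_index T)"
      unfolding l2_summable_on_def coeff_index_def square_summable_coeffs_def eq
      by (intro nonneg_summable_triple) auto
  next
    assume *: "l2_summable_on (coeff_family c) (coeff_index T)"
    from abs_summable_triple[OF this[unfolded l2_summable_on_def coeff_index_def eq]]
    show "square_summable_coeffs T c"
      unfolding square_summable_coeffs_def by (auto simp: sums_iff)
  qed
qed

lemma square_summable_coeffs_sums:
  assumes "square_summable_coeffs T c"
  shows "(\<lambda>k. \<Sum>l=1..harmonic_dim T k. \<Sum>j. (cmod (c k l j))\<^sup>2) sums
    (l2_norm_on (coeff_family c) (coeff_index T))\<^sup>2"
proof -
  have eq: "(\<lambda>p. (cmod (coeff_family c p))\<^sup>2) = (\<lambda>(k, l, j). norm ((cmod (c k l j))\<^sup>2))"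
    by (auto simp: coeff_family_def)
  show ?thesis
    using abs_summable_triple(2)[OF assms[unfolded square_summable_coeffs_iff l2_summable_on_def coeff_index_def eq]]
    unfolding l2_norm_on_power2 coeff_index_def by (simp add: coeff_family_def case_prod_unfold)
qed

lemma square_summable_coeffs_summable:
  "square_summable_coeffs T c \<Longrightarrow> l \<in> {1..harmonic_dim T k} \<Longrightarrow> summable (\<lambda>j. (cmod (c k l j))\<^sup>2)"
  by (simp add: square_summable_coeffs_def)

lemma parity_series_sums:
  assumes "summable (\<lambda>j. (cmod (c j))\<^sup>2)" "z \<in> ball 0 1"
  shows "(\<lambda>j. c j * z ^ (k + 2 * j)) sums (z ^ k * (\<Sum>j. c j * z ^ (2 * j)))"
proof -
  have "cmod (z\<^sup>2) < 1" using assms(2) by (simp add: norm_power abs_square_less_1)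
  from sums_mult[OF summable_sums[OF square_summable_power_series[OF assms(1) this]], of "z ^ k"]
  show ?thesis by (simp add: power_add power_mult mult_ac flip: power_mult)
qed

text \<open>Squaring the coordinates and adding them gives z^2 = z'^2, as both directions have norm
  1. These fibres decide whether an expression in z and \<theta> is well defined on the
  ball.\<close>

lemma kd_point_eq_iff:
  assumes "\<theta> \<in> sphere 0 1" "\<theta>' \<in> sphere 0 1" "kd_point z \<theta> = kd_point z' \<theta>'"
  shows "z = 0 \<and> z' = 0 \<or> z' = z \<and> \<theta>' = \<theta> \<or> z' = - z \<and> \<theta>' = - \<theta>"
proof -
  have comp: "z * of_real (\<theta> $ i) = z' * of_real (\<theta>' $ i)" for i
    using assms(3) by (auto simp: kd_point_def vec_eq_iff)
  have "z\<^sup>2 * norm_sq \<theta> = z'\<^sup>2 * norm_sq \<theta>'"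
    unfolding norm_sq_alt sum_distrib_left
    using comp by (intro sum.cong refl) (metis power_mult_distrib)
  then have "z\<^sup>2 = z'\<^sup>2" using assms by (simp add: norm_sq_def)
  then consider "z = 0" "z' = 0" | "z' = z" "z \<noteq> 0" | "z' = - z" "z \<noteq> 0"
    by (cases "z = 0") (auto simp: power2_eq_iff)
  then show ?thesis
  proof cases
    case 2
    then have "\<theta>' = \<theta>" using comp by (auto simp: vec_eq_iff)
    then show ?thesis using 2 by simp
  next
    case 3
    have "\<theta>' $ i = - \<theta> $ i" for i
    proof -
      have "z * (of_real (\<theta>' $ i) + of_real (\<theta> $ i)) = 0"
        using comp[of i] 3 by (simp add: distrib_left)
      then have "complex_of_real (\<theta>' $ i + \<theta> $ i) = 0"
        using 3 by simp
      then show ?thesis unfolding of_real_eq_0_iff by linarith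
    qed
    then have "\<theta>' = - \<theta>" by (simp add: vec_eq_iff)
    then show ?thesis using 3 by simp
  qed simp
qed

section \<open>Synthesis of a function from its coefficients\<close>

context spherical_basis
begin

text \<open>Pairing a coefficient family with this one, without conjugation, is evaluation at the
  point.\<close>

definition term_at :: "complex \<Rightarrow> real^'n \<Rightarrow> nat \<times> nat \<times> nat \<Rightarrow> complex" where
  "term_at z \<theta> = (\<lambda>(k, l, j). z ^ (k + 2 * j) * Y k l \<theta>)"

lemma term_at_apply [simp]: "term_at z \<theta> (k, l, j) = z ^ (k + 2 * j) * Y k l \<theta>"
  by (simp add: term_at_def)

text \<open>Summing over j and l leaves the sum over k of |z|^(2k) \<open>kernel k \<theta>\<close>
  / (1 - |z|^4), which converges because the kernel grows at most polynomially in k.\<close>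

lemma term_at_l2_summable:
  assumes z: "z \<in> ball 0 1" and \<theta>: "\<theta> \<in> sphere 0 1"
  shows "l2_summable_on (term_at z \<theta>) (coeff_index TYPE('n))"
proof -
  let ?x = "(cmod z)\<^sup>2"
  have x: "0 \<le> ?x" "?x < 1" "0 \<le> ?x\<^sup>2" "?x\<^sup>2 < 1"
    using z by (auto simp: abs_square_less_1 power_less_one_iff)
  have "(cmod z ^ (k + 2 * j))\<^sup>2 = ?x ^ k * (?x\<^sup>2) ^ j" for k j
    by (simp only: power_mult[symmetric] power_add[symmetric]) (rule arg_cong[where f = "power (cmod z)"], simp)
  then have eq: "(\<lambda>p. (cmod (term_at z \<theta> p))\<^sup>2) =
      (\<lambda>(k, l, j). ?x ^ k * (cmod (Y k l \<theta>))\<^sup>2 * (?x\<^sup>2) ^ j)"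
    by (auto simp: term_at_def fun_eq_iff norm_mult norm_power power_mult_distrib)
  have geo: "(\<lambda>j. ?x ^ k * (cmod (Y k l \<theta>))\<^sup>2 * (?x\<^sup>2) ^ j) sums (?x ^ k * (cmod (Y k l \<theta>))\<^sup>2 * (1 / (1 - ?x\<^sup>2)))" for k l
    using x by (intro sums_mult geometric_sums) simp
  obtain C where C: "C \<ge> 0" "\<And>k \<theta>. \<theta> \<in> sphere 0 1 \<Longrightarrow> kernel k \<theta> \<le> C * (real k + 1) ^ CARD('n)"
    using kernel_bound by blast
  have "summable (\<lambda>k. ?x ^ k * kernel k \<theta> * (1 / (1 - ?x\<^sup>2)))"
  proof (rule summable_comparison_test'[where N = 0])
    show "summable (\<lambda>k. C * (1 / (1 - ?x\<^sup>2)) * ((real k + 1) ^ CARD('n) * ?x ^ k))"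
      using x by (intro summable_mult summable_polynomial_times_power)
    fix k
    have "0 \<le> kernel k \<theta>" by (simp add: kernel_def sum_nonneg)
    then have "norm (?x ^ k * kernel k \<theta> * (1 / (1 - ?x\<^sup>2))) = ?x ^ k * kernel k \<theta> * (1 / (1 - ?x\<^sup>2))"
      using x by simp
    also have "\<dots> \<le> ?x ^ k * (C * (real k + 1) ^ CARD('n)) * (1 / (1 - ?x\<^sup>2))"
      using x C(2)[OF \<theta>] by (intro mult_right_mono mult_left_mono) auto
    finally show "norm (?x ^ k * kernel k \<theta> * (1 / (1 - ?x\<^sup>2))) \<le>
        C * (1 / (1 - ?x\<^sup>2)) * ((real k + 1) ^ CARD('n) * ?x ^ k)"
      by (simp only: mult_ac)
  qed
  then have "summable (\<lambda>k. \<Sum>l=1..harmonic_dim TYPE('n) k. ?x ^ k * (cmod (Y k l \<theta>))\<^sup>2 * (1 / (1 - ?x\<^sup>2)))"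
    by (simp only: kernel_def sum_distrib_left sum_distrib_right)
  then show ?thesis
    unfolding l2_summable_on_def coeff_index_def eq
    using x geo by (intro nonneg_summable_triple) (auto simp: sums_iff)
qed

text \<open>The Cauchy-Schwarz principle: the terms are products of two square summable families,
  the coefficients and \<open>term_at\<close>.\<close>

lemma expansion_abs_summable:
  assumes c: "square_summable_coeffs TYPE('n) c" and z: "z \<in> ball 0 1" and \<theta>: "\<theta> \<in> sphere 0 1"
  shows "(\<lambda>(k, l, j). norm (c k l j * z ^ (k + 2 * j) * Y k l \<theta>)) summable_on (coeff_index TYPE('n))"
proof -
  have "(\<lambda>p. norm (coeff_family c p * term_at z \<theta> p)) summable_on (coeff_index TYPE('n))"
    using abs_summable_product[of "coeff_family c" "coeff_index TYPE('n)" "term_at z \<theta>"]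
      term_at_l2_summable[OF z \<theta>] c
    by (simp add: l2_summable_on_def square_summable_coeffs_iff norm_mult power2_eq_square)
  also have "(\<lambda>p. norm (coeff_family c p * term_at z \<theta> p)) =
      (\<lambda>(k, l, j). norm (c k l j * z ^ (k + 2 * j) * Y k l \<theta>))"
    by (auto simp: fun_eq_iff mult.assoc)
  finally show ?thesis .
qed

text \<open>An unordered sum can be regrouped by the total degree k + 2 j as well as by k.\<close>

definition expansion_sum :: "(nat \<Rightarrow> nat \<Rightarrow> nat \<Rightarrow> complex) \<Rightarrow> complex \<Rightarrow> real^'n \<Rightarrow> complex" where
  "expansion_sum c z \<theta> = (\<Sum>\<^sub>\<infinity>(k, l, j)\<in>coeff_index TYPE('n). c k l j * z ^ (k + 2 * j) * Y k l \<theta>)"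

lemma expansion_sums:
  assumes c: "square_summable_coeffs TYPE('n) c" and z: "z \<in> ball 0 1" and \<theta>: "\<theta> \<in> sphere 0 1"
  shows "l \<in> {1..harmonic_dim TYPE('n) k} \<Longrightarrow> summable (\<lambda>j. c k l j * z ^ (k + 2 * j) * Y k l \<theta>)"
    and "(\<lambda>k. \<Sum>l = 1..harmonic_dim TYPE('n) k. \<Sum>j. c k l j * z ^ (k + 2 * j) * Y k l \<theta>)
          sums expansion_sum c z \<theta>"
  using abs_summable_triple[OF expansion_abs_summable[OF assms, unfolded coeff_index_def]]
  unfolding expansion_sum_def coeff_index_def by (auto intro: summable_norm_cancel)

text \<open>The value is computed from an arbitrary choice of z and \<theta>;
  \<open>synthesis_kd_point\<close> shows that the choice is immaterial.\<close>

definition synthesis :: "(nat \<Rightarrow> nat \<Rightarrow> nat \<Rightarrow> complex) \<Rightarrow> complex^'n \<Rightarrow> complex" where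
  "synthesis c x = (if x \<in> kd_ball then
     (case (SOME p. x = kd_point (fst p) (snd p) \<and> fst p \<in> ball 0 1 \<and> snd p \<in> sphere 0 1) of
       (z, \<theta>) \<Rightarrow> expansion_sum c z \<theta>) else 0)"

text \<open>Each term agrees at identified points: replacing z and \<theta> by their negatives
  multiplies both the power of z and \<open>Y k l\<close> by (-1)^k, and the signs cancel.\<close>

lemma synthesis_kd_point:
  assumes z: "z \<in> ball 0 1" and \<theta>: "\<theta> \<in> sphere 0 1"
  shows "synthesis c (kd_point z \<theta>) = expansion_sum c z \<theta>"
proof -
  define p where "p = (SOME p. kd_point z \<theta> = kd_point (fst p) (snd p) \<and> fst p \<in> ball 0 1 \<and> snd p \<in> sphere 0 1)"
  have p: "kd_point z \<theta> = kd_point (fst p) (snd p) \<and> fst p \<in> ball 0 1 \<and> snd p \<in> sphere 0 1"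
    unfolding p_def by (rule someI[of _ "(z, \<theta>)"]) (use z \<theta> in auto)
  have "kd_point z \<theta> \<in> kd_ball" using z \<theta> by (auto simp: kd_ball_def)
  then have "synthesis c (kd_point z \<theta>) = expansion_sum c (fst p) (snd p)"
    by (simp only: synthesis_def p_def[symmetric] case_prod_unfold if_True)
  also have "\<dots> = expansion_sum c z \<theta>"
    unfolding expansion_sum_def
  proof (rule infsum_cong)
    fix q assume "q \<in> coeff_index TYPE('n)"
    then obtain k l j where q: "q = (k, l, j)" and l': "l \<in> {1..harmonic_dim TYPE('n) k}"
      by (cases q) auto
    consider "z = 0" "fst p = 0" | "fst p = z" "snd p = \<theta>" | "fst p = - z" "snd p = - \<theta>"
      using kd_point_eq_iff[of \<theta> "snd p" z "fst p"] p \<theta> by auto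
    then have "fst p ^ (k + 2 * j) * Y k l (snd p) = z ^ (k + 2 * j) * Y k l \<theta>"
    proof cases
      case 1
      show ?thesis
      proof (cases "k = 0")
        \<comment> \<open>At z = 0 only terms with k = 0 could depend on \<theta>. A harmonic of
          degree 0 is constant: scale by t = 0 and use 0^0 = 1.\<close>
        case True
        then show ?thesis
          using Y_scaleR[OF l', of 0 "snd p"] Y_scaleR[OF l', of 0 \<theta>] 1 by simp
      qed (use 1 in simp)
    next
      case 3
      have "Y k l (- \<theta>) = (- 1) ^ k * Y k l \<theta>"
        using Y_scaleR[OF l', of "- 1" \<theta>] by simp
      moreover have "(- z) ^ (k + 2 * j) = (- 1) ^ k * z ^ (k + 2 * j)"
        by (simp add: power_add power_mult power_minus[of z k])
      moreover have "(- 1) ^ k * (- 1) ^ k = (1 :: complex)"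
        by (simp flip: power_mult_distrib)
      ultimately show ?thesis using 3 by simp
    qed simp
    then show "(case q of (k, l, j) \<Rightarrow> c k l j * fst p ^ (k + 2 * j) * Y k l (snd p)) =
        (case q of (k, l, j) \<Rightarrow> c k l j * z ^ (k + 2 * j) * Y k l \<theta>)"
      by (simp add: q mult.assoc)
  qed
  finally show ?thesis .
qed

lemma synthesis_kd_functions: "synthesis c \<in> kd_functions"
  by (simp add: kd_functions_def synthesis_def)

lemma synthesis_power_expansion:
  assumes "square_summable_coeffs TYPE('n) c"
  shows "power_expansion Y c (synthesis c)"
  unfolding power_expansion_def
  using expansion_sums[OF assms] by (auto simp: synthesis_kd_point)

lemma power_expansion_eq_expansion_sum:
  assumes "square_summable_coeffs TYPE('n) c" "power_expansion Y c f" "z \<in> ball 0 1" "\<theta> \<in> sphere 0 1"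
  shows "f (kd_point z \<theta>) = expansion_sum c z \<theta>"
proof -
  have "(\<lambda>k. \<Sum>l = 1..harmonic_dim TYPE('n) k. \<Sum>j. c k l j * z ^ (k + 2 * j) * Y k l \<theta>) sums f (kd_point z \<theta>)"
    using assms by (auto simp: power_expansion_def)
  then show ?thesis using expansion_sums(2)[OF assms(1,3,4)] sums_unique2 by blast
qed

section \<open>Uniqueness of the coefficients\<close>

text \<open>For fixed \<theta>, regrouping by m = k + 2 j gives a power series in z that vanishes on
  the disc, so each of its coefficients is 0.\<close>

lemma expansion_zero_homogeneous:
  assumes c: "square_summable_coeffs TYPE('n) c"
    and 0: "\<And>z. z \<in> ball 0 1 \<Longrightarrow> expansion_sum c z \<theta> = 0" and \<theta>: "\<theta> \<in> sphere 0 1"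
  shows "(\<Sum>j\<le>m div 2. \<Sum>l=1..harmonic_dim TYPE('n) (m - 2 * j). c (m - 2 * j) l j * Y (m - 2 * j) l \<theta>) = 0"
proof -
  \<comment> \<open>The pairs (j, l) that contribute to the power m, with degree k = m - 2 j; the
    bound j \<le> m div 2 keeps the subtraction exact.\<close>
  define S where "S m = (SIGMA j:{..m div 2}. {1..harmonic_dim TYPE('n) (m - 2 * j)})" for m
  define g :: "nat \<times> nat \<times> nat \<Rightarrow> nat \<times> nat \<times> nat" where "g = (\<lambda>(m, j, l). (m - 2 * j, l, j))"
  have bij: "bij_betw g (SIGMA m:UNIV. S m) (coeff_index TYPE('n))"
    by (rule bij_betw_byWitness[where f' = "\<lambda>(k, l, j). (k + 2 * j, j, l)"])
      (auto simp: g_def S_def coeff_index_def)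
  define w where "w m = (\<Sum>(j, l)\<in>S m. c (m - 2 * j) l j * Y (m - 2 * j) l \<theta>)" for m
  have fin: "finite (S m)" for m by (simp add: S_def)
  have "(\<lambda>m. w m * z ^ m) sums 0" if z: "z \<in> ball 0 1" for z
  proof -
    let ?F = "\<lambda>(k, l, j). c k l j * z ^ (k + 2 * j) * Y k l \<theta>"
    have "?F summable_on coeff_index TYPE('n)"
      by (rule Infinite_Sum.abs_summable_summable)
        (use expansion_abs_summable[OF c z \<theta>] in \<open>simp add: case_prod_unfold\<close>)
    then have s: "(\<lambda>p. ?F (g p)) summable_on (SIGMA m:UNIV. S m)"
      by (subst summable_on_reindex_bij_betw[OF bij])
    have inner: "infsum (\<lambda>p. ?F (g (m, p))) (S m) = w m * z ^ m" for m
      using fin by (auto simp: w_def sum_distrib_right g_def S_def intro!: sum.cong)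
    have s': "(\<lambda>(m, p). ?F (g (m, p))) summable_on (SIGMA m:UNIV. S m)"
      using s by (simp add: case_prod_unfold)
    have "(\<lambda>m. w m * z ^ m) summable_on UNIV"
      using summable_on_Sigma_banach[OF s'] unfolding inner .
    moreover have "infsum (\<lambda>m. w m * z ^ m) UNIV = 0"
    proof -
      have "infsum (\<lambda>m. w m * z ^ m) UNIV = infsum (\<lambda>p. ?F (g p)) (SIGMA m:UNIV. S m)"
        using infsum_Sigma_banach[OF s] unfolding inner .
      also have "\<dots> = expansion_sum c z \<theta>"
        unfolding expansion_sum_def by (rule infsum_reindex_bij_betw[OF bij])
      finally show ?thesis using 0[OF z] by simp
    qed
    ultimately show ?thesis by (intro has_sum_imp_sums) (simp add: has_sum_iff)
  qed
  then have "w m = 0" by (rule power_series_zero_coeffs)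
  then show ?thesis
    unfolding w_def S_def by (simp add: sum.Sigma)
qed

text \<open>With m = k + 2 j, the relation for the power m on the sphere extends by homogeneity to
  all x, with weights |x|^(2i). Then \<open>harmonic_components_zero\<close> isolates the j-th
  harmonic and \<open>Y_independent\<close> its coefficients.\<close>

lemma expansion_zero_coeffs:
  assumes c: "square_summable_coeffs TYPE('n) c"
    and 0: "\<And>z \<theta>. z \<in> ball 0 1 \<Longrightarrow> \<theta> \<in> sphere 0 1 \<Longrightarrow> expansion_sum c z \<theta> = 0"
    and l: "l \<in> {1..harmonic_dim TYPE('n) k}"
  shows "c k l j = 0"
proof -
  define m where "m = k + 2 * j"
  define h where "h i x = (\<Sum>l=1..harmonic_dim TYPE('n) (m - 2 * i). c (m - 2 * i) l i * Y (m - 2 * i) l x)" for i x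
  have h: "h i \<in> harmonics (m - 2 * i)" for i
    unfolding h_def by (rule harmonics_combination)
  have sphere0: "(\<Sum>i\<le>m div 2. h i \<theta>) = 0" if "\<theta> \<in> sphere 0 1" for \<theta>
    unfolding h_def by (rule expansion_zero_homogeneous[OF c 0]) (use that in auto)
  have "(\<Sum>i\<le>m div 2. norm_sq x ^ i * h i x) = 0" for x
  proof -
    \<comment> \<open>Polar coordinates; at the origin the radius is 0 and any unit vector serves as
      direction.\<close>
    obtain r \<theta> where r: "x = r *\<^sub>R \<theta>" and \<theta>: "\<theta> \<in> sphere (0::real^'n) 1"
    proof (cases "x = 0")
      case True
      obtain i :: 'n where True by simp
      show ?thesis by (rule that[of 0 "axis i 1"]) (use True in auto)
    next
      case False
      show ?thesis by (rule that[of "norm x" "x /\<^sub>R norm x"]) (use False in auto)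
    qed
    have "norm_sq x ^ i * h i x = of_real r ^ m * h i \<theta>" if "i \<in> {..m div 2}" for i
    proof -
      have "m = 2 * i + (m - 2 * i)" using that by auto
      then have "of_real r ^ m = (of_real r ^ 2) ^ i * (of_real r :: complex) ^ (m - 2 * i)"
        by (metis power_add power_mult)
      moreover have "norm_sq \<theta> = 1" using \<theta> by (simp add: norm_sq_def)
      ultimately show ?thesis
        by (simp add: r norm_sq_scaleR harmonicsD(2)[OF h])
    qed
    then have "(\<Sum>i\<le>m div 2. norm_sq x ^ i * h i x) = (\<Sum>i\<le>m div 2. of_real r ^ m * h i \<theta>)"
      by (rule sum.cong[OF refl])
    then show ?thesis
      using sphere0[OF \<theta>] by (simp flip: sum_distrib_left)
  qed
  then have "h j x = 0" for x
    by (rule harmonic_components_zero[of "m div 2" h "\<lambda>i. m - 2 * i", OF h]) (simp add: m_def)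
  then have "(\<Sum>l=1..harmonic_dim TYPE('n) k. c k l j * Y k l \<theta>) = 0" for \<theta>
    by (simp add: h_def m_def)
  from Y_independent[OF this l] show ?thesis .
qed

lemma square_summable_coeffs_diff:
  assumes "square_summable_coeffs TYPE('n) c" "square_summable_coeffs TYPE('n) c'"
  shows "square_summable_coeffs TYPE('n) (\<lambda>k l j. c k l j - c' k l j)"
    and "coeff_family (\<lambda>k l j. c k l j - c' k l j) = (\<lambda>p. coeff_family c p - coeff_family c' p)"
proof -
  show *: "coeff_family (\<lambda>k l j. c k l j - c' k l j) = (\<lambda>p. coeff_family c p - coeff_family c' p)"
    by (auto simp: coeff_family_def)
  show "square_summable_coeffs TYPE('n) (\<lambda>k l j. c k l j - c' k l j)"
    using assms unfolding square_summable_coeffs_iff * by (rule l2_on_diff)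
qed

lemma power_expansion_diff:
  assumes "power_expansion Y c f" "power_expansion Y c' g"
  shows "power_expansion Y (\<lambda>k l j. c k l j - c' k l j) (f - g)"
  unfolding power_expansion_def
proof (intro ballI conjI allI)
  fix z \<theta> assume z: "z \<in> ball (0::complex) 1" and \<theta>: "\<theta> \<in> sphere (0::real^'n) 1"
  have s: "summable (\<lambda>j. c k l j * z ^ (k + 2 * j) * Y k l \<theta>)" "summable (\<lambda>j. c' k l j * z ^ (k + 2 * j) * Y k l \<theta>)"
    if "l \<in> {1..harmonic_dim TYPE('n) k}" for k l
    using assms z \<theta> that by (auto simp: power_expansion_def)
  then show "summable (\<lambda>j. (c k l j - c' k l j) * z ^ (k + 2 * j) * Y k l \<theta>)"
    if "l \<in> {1..harmonic_dim TYPE('n) k}" for k l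
    using summable_diff[OF s] that by (simp add: left_diff_distrib)
  have "(\<lambda>k. (\<Sum>l = 1..harmonic_dim TYPE('n) k. \<Sum>j. c k l j * z ^ (k + 2 * j) * Y k l \<theta>) -
      (\<Sum>l = 1..harmonic_dim TYPE('n) k. \<Sum>j. c' k l j * z ^ (k + 2 * j) * Y k l \<theta>))
      sums (f (kd_point z \<theta>) - g (kd_point z \<theta>))"
    using assms z \<theta> by (intro sums_diff) (auto simp: power_expansion_def)
  moreover have "(\<Sum>l = 1..harmonic_dim TYPE('n) k. \<Sum>j. c k l j * z ^ (k + 2 * j) * Y k l \<theta>) -
      (\<Sum>l = 1..harmonic_dim TYPE('n) k. \<Sum>j. c' k l j * z ^ (k + 2 * j) * Y k l \<theta>) =
      (\<Sum>l = 1..harmonic_dim TYPE('n) k. \<Sum>j. (c k l j - c' k l j) * z ^ (k + 2 * j) * Y k l \<theta>)" for k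
    unfolding sum_subtractf[symmetric] left_diff_distrib
    by (intro sum.cong refl suminf_diff s)
  ultimately show "(\<lambda>k. \<Sum>l = 1..harmonic_dim TYPE('n) k. \<Sum>j. (c k l j - c' k l j) * z ^ (k + 2 * j) * Y k l \<theta>)
      sums (f - g) (kd_point z \<theta>)"
    by (simp add: minus_apply)
qed

text \<open>The difference of the two families expands the zero function.\<close>

lemma coeffs_unique:
  assumes c: "square_summable_coeffs TYPE('n) c" "power_expansion Y c f"
    and c': "square_summable_coeffs TYPE('n) c'" "power_expansion Y c' f"
    and l: "l \<in> {1..harmonic_dim TYPE('n) k}"
  shows "c k l j = c' k l j"
proof -
  note sq = square_summable_coeffs_diff(1)[OF c(1) c'(1)]
  have "expansion_sum (\<lambda>k l j. c k l j - c' k l j) z \<theta> = 0" if "z \<in> ball 0 1" "\<theta> \<in> sphere 0 1" for z \<theta>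
    using power_expansion_eq_expansion_sum[OF sq power_expansion_diff[OF c(2) c'(2)] that] by simp
  from expansion_zero_coeffs[OF sq this l] show ?thesis by simp
qed

section \<open>Equivalence of the two descriptions of the space, and the norm\<close>

text \<open>The norms of the given \<open>F\<close> are kept in the conclusion because
  \<open>poly_hardy_norm\<close> is computed from an \<open>F\<close> picked by choice.\<close>

lemma hardy_expansion_power_expansion:
  assumes "hardy_expansion Y F f"
  obtains c where "square_summable_coeffs TYPE('n) c" "power_expansion Y c f"
    "\<And>k l. l \<in> {1..harmonic_dim TYPE('n) k} \<Longrightarrow> (hardy_norm (F k l))\<^sup>2 = (\<Sum>j. (cmod (c k l j))\<^sup>2)"
proof -
  have "F k l \<in> hardy_parity k" if "l \<in> {1..harmonic_dim TYPE('n) k}" for k l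
    using assms that by (simp add: hardy_expansion_def)
  then have "\<forall>k l. \<exists>c. l \<in> {1..harmonic_dim TYPE('n) k} \<longrightarrow> summable (\<lambda>j. (cmod (c j))\<^sup>2) \<and>
     (\<forall>z\<in>ball 0 1. (\<lambda>j. c j * z ^ (k + 2 * j)) sums F k l z)"
    unfolding hardy_parity_iff by meson
  then obtain c where c: "\<And>k l. l \<in> {1..harmonic_dim TYPE('n) k} \<Longrightarrow> summable (\<lambda>j. (cmod (c k l j))\<^sup>2)"
    "\<And>k l z. l \<in> {1..harmonic_dim TYPE('n) k} \<Longrightarrow> z \<in> ball 0 1 \<Longrightarrow> (\<lambda>j. c k l j * z ^ (k + 2 * j)) sums F k l z"
    by metis
  have norm: "(hardy_norm (F k l))\<^sup>2 = (\<Sum>j. (cmod (c k l j))\<^sup>2)" if "l \<in> {1..harmonic_dim TYPE('n) k}" for k l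
    by (rule hardy_parity_norm(1)[where k = k]) (use c that in auto)
  have "summable (\<lambda>k. \<Sum>l = 1..harmonic_dim TYPE('n) k. (hardy_norm (F k l))\<^sup>2)"
    using assms by (simp add: hardy_expansion_def)
  then have "summable (\<lambda>k. \<Sum>l = 1..harmonic_dim TYPE('n) k. \<Sum>j. (cmod (c k l j))\<^sup>2)"
    by (simp only: norm cong: sum.cong)
  then have "square_summable_coeffs TYPE('n) c"
    using c(1) by (simp add: square_summable_coeffs_def)
  moreover have "power_expansion Y c f"
    unfolding power_expansion_def
  proof (intro ballI conjI allI)
    fix z \<theta> assume z: "z \<in> ball (0::complex) 1" and \<theta>: "\<theta> \<in> sphere (0::real^'n) 1"
    have s: "(\<lambda>j. c k l j * z ^ (k + 2 * j) * Y k l \<theta>) sums (F k l z * Y k l \<theta>)"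
      if "l \<in> {1..harmonic_dim TYPE('n) k}" for k l
      by (intro sums_mult2 c that z)
    then show "summable (\<lambda>j. c k l j * z ^ (k + 2 * j) * Y k l \<theta>)"
      if "l \<in> {1..harmonic_dim TYPE('n) k}" for k l using that sums_summable by blast
    have "(\<lambda>k. \<Sum>l = 1..harmonic_dim TYPE('n) k. F k l z * Y k l \<theta>) sums f (kd_point z \<theta>)"
      using assms z \<theta> by (auto simp: hardy_expansion_def)
    then show "(\<lambda>k. \<Sum>l = 1..harmonic_dim TYPE('n) k. \<Sum>j. c k l j * z ^ (k + 2 * j) * Y k l \<theta>) sums f (kd_point z \<theta>)"
      by (simp only: sums_unique[OF s, symmetric] cong: sum.cong)
  qed
  ultimately show ?thesis using norm that by blast
qed

text \<open>The components chosen here are the functions whose circle means occur in the norm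
  formula.\<close>

lemma power_expansion_hardy_expansion:
  assumes c: "square_summable_coeffs TYPE('n) c" "power_expansion Y c f"
  shows "hardy_expansion Y (\<lambda>k l z. z ^ k * (\<Sum>j. c k l j * z ^ (2 * j))) f"
proof -
  have s: "(\<lambda>j. c k l j * z ^ (k + 2 * j)) sums (z ^ k * (\<Sum>j. c k l j * z ^ (2 * j)))"
    if "l \<in> {1..harmonic_dim TYPE('n) k}" "z \<in> ball 0 1" for k l z
    by (rule parity_series_sums) (use square_summable_coeffs_summable[OF c(1)] that in auto)
  have norm: "(hardy_norm (\<lambda>z. z ^ k * (\<Sum>j. c k l j * z ^ (2 * j))))\<^sup>2 = (\<Sum>j. (cmod (c k l j))\<^sup>2)"
    if "l \<in> {1..harmonic_dim TYPE('n) k}" for k l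
    by (rule hardy_parity_norm(1)) (use s square_summable_coeffs_summable[OF c(1)] that in auto)
  have summ: "summable (\<lambda>k. \<Sum>l = 1..harmonic_dim TYPE('n) k. \<Sum>j. (cmod (c k l j))\<^sup>2)"
    using c(1) by (simp add: square_summable_coeffs_def)
  show ?thesis
    unfolding hardy_expansion_def
  proof (intro ballI conjI allI)
    fix k l assume l: "l \<in> {1..harmonic_dim TYPE('n) k}"
    show "(\<lambda>z. z ^ k * (\<Sum>j. c k l j * z ^ (2 * j))) \<in> hardy_parity k"
      unfolding hardy_parity_iff using s[OF l] square_summable_coeffs_summable[OF c(1) l] by blast
  next
    show "summable (\<lambda>k. \<Sum>l = 1..harmonic_dim TYPE('n) k. (hardy_norm (\<lambda>z. z ^ k * (\<Sum>j. c k l j * z ^ (2 * j))))\<^sup>2)"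
      using summ by (simp only: norm cong: sum.cong)
  next
    fix z \<theta> assume z: "z \<in> ball (0::complex) 1" and \<theta>: "\<theta> \<in> sphere (0::real^'n) 1"
    have "(\<lambda>k. \<Sum>l = 1..harmonic_dim TYPE('n) k. \<Sum>j. c k l j * z ^ (k + 2 * j) * Y k l \<theta>) sums f (kd_point z \<theta>)"
      using c z \<theta> by (auto simp: power_expansion_def)
    moreover have eq: "(\<Sum>j. c k l j * z ^ (k + 2 * j) * Y k l \<theta>) = z ^ k * (\<Sum>j. c k l j * z ^ (2 * j)) * Y k l \<theta>"
      if "l \<in> {1..harmonic_dim TYPE('n) k}" for k l
      using sums_unique[OF sums_mult2[OF s[OF that z], of "Y k l \<theta>"]] by simp
    ultimately show "(\<lambda>k. \<Sum>l = 1..harmonic_dim TYPE('n) k. z ^ k * (\<Sum>j. c k l j * z ^ (2 * j)) * Y k l \<theta>)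
        sums f (kd_point z \<theta>)"
      by (simp only: eq cong: sum.cong)
  qed
qed

lemma poly_hardy_iff:
  "f \<in> poly_hardy Y \<longleftrightarrow> f \<in> kd_functions \<and> (\<exists>c. square_summable_coeffs TYPE('n) c \<and> power_expansion Y c f)"
  unfolding poly_hardy_def
  by (auto elim!: hardy_expansion_power_expansion intro: power_expansion_hardy_expansion)

text \<open>Whichever \<open>F\<close> the choice in \<open>poly_hardy_norm\<close> selects, its
  coefficients are those of \<open>c\<close> by \<open>coeffs_unique\<close>, so the value depends
  on \<open>f\<close> alone.\<close>

lemma poly_hardy_norm_eq:
  assumes c: "square_summable_coeffs TYPE('n) c" "power_expansion Y c f"
  shows "poly_hardy_norm Y f = l2_norm_on (coeff_family c) (coeff_index TYPE('n))"
proof -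
  define F where "F = (SOME F. hardy_expansion Y F f)"
  have "hardy_expansion Y F f"
    unfolding F_def
    by (rule someI[of "\<lambda>F. hardy_expansion Y F f", OF power_expansion_hardy_expansion[OF c]])
  then obtain c' where c': "square_summable_coeffs TYPE('n) c'" "power_expansion Y c' f"
    "\<And>k l. l \<in> {1..harmonic_dim TYPE('n) k} \<Longrightarrow> (hardy_norm (F k l))\<^sup>2 = (\<Sum>j. (cmod (c' k l j))\<^sup>2)"
    by (rule hardy_expansion_power_expansion) (rule that)
  let ?a = "\<lambda>k. \<Sum>l = 1..harmonic_dim TYPE('n) k. (hardy_norm (F k l))\<^sup>2"
  have "?a = (\<lambda>k. \<Sum>l = 1..harmonic_dim TYPE('n) k. \<Sum>j. (cmod (c k l j))\<^sup>2)"
    by (intro ext sum.cong refl) (simp only: c'(3) coeffs_unique[OF c'(1,2) c])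
  then have "?a sums (l2_norm_on (coeff_family c) (coeff_index TYPE('n)))\<^sup>2"
    using square_summable_coeffs_sums[OF c(1)] by simp
  then have "(?a has_sum (l2_norm_on (coeff_family c) (coeff_index TYPE('n)))\<^sup>2) UNIV"
    by (rule sums_nonneg_imp_has_sum) (auto intro: sum_nonneg)
  then show ?thesis
    by (simp add: poly_hardy_norm_def Let_def F_def[symmetric] infsumI l2_norm_on_nonneg)
qed

text \<open>\<open>Metric_space\<close> demands symmetry for all functions, also outside the space,
  so differences without an expansion are treated as well.\<close>

lemma poly_hardy_norm_minus_commute: "poly_hardy_norm Y (f - g) = poly_hardy_norm Y (g - f)"
proof (cases "\<exists>F. hardy_expansion Y F (f - g) \<or> hardy_expansion Y F (g - f)")
  case True
  have "poly_hardy_norm Y (f - g) = poly_hardy_norm Y (g - f)" if "hardy_expansion Y F (f - g)" for f g F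
  proof -
    obtain c where c: "square_summable_coeffs TYPE('n) c" "power_expansion Y c (f - g)"
      by (rule hardy_expansion_power_expansion[OF \<open>hardy_expansion Y F (f - g)\<close>]) (rule that)
    \<comment> \<open>The zero family makes negation a special case of subtraction.\<close>
    have z: "square_summable_coeffs TYPE('n) (\<lambda>k l j. 0)" "power_expansion Y (\<lambda>k l j. 0) 0"
      by (auto simp: square_summable_coeffs_def power_expansion_def)
    have "power_expansion Y (\<lambda>k l j. 0 - c k l j) (g - f)"
      using power_expansion_diff[OF z(2) c(2)] by simp
    then show ?thesis
      using poly_hardy_norm_eq[OF c] poly_hardy_norm_eq[OF square_summable_coeffs_diff(1)[OF z(1) c(1)]]
      by (auto simp: coeff_family_def intro: l2_norm_on_cong)
  qed
  then show ?thesis using True by metis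
next
  \<comment> \<open>Neither difference has an expansion, so both \<open>SOME\<close> terms choose
    from the same empty predicate and denote the same \<open>F\<close>.\<close>
  case False
  then show ?thesis by (simp add: poly_hardy_norm_def)
qed

lemma poly_hardy_norm_nonneg: "0 \<le> poly_hardy_norm Y f"
  by (simp add: poly_hardy_norm_def Let_def infsum_nonneg sum_nonneg)

lemma poly_hardy_dist_eq:
  assumes "square_summable_coeffs TYPE('n) c" "power_expansion Y c f"
    "square_summable_coeffs TYPE('n) c'" "power_expansion Y c' g"
  shows "poly_hardy_dist Y f g =
    l2_norm_on (\<lambda>p. coeff_family c p - coeff_family c' p) (coeff_index TYPE('n))"
  unfolding poly_hardy_dist_def
  using poly_hardy_norm_eq[OF square_summable_coeffs_diff(1) power_expansion_diff] assms
  by (simp add: square_summable_coeffs_diff(2))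

lemma kd_functions_eqI:
  assumes "f \<in> kd_functions" "g \<in> kd_functions"
    "\<And>z \<theta>. z \<in> ball 0 1 \<Longrightarrow> \<theta> \<in> sphere 0 1 \<Longrightarrow> f (kd_point z \<theta>) = g (kd_point z \<theta>)"
  shows "f = g"
proof
  fix x show "f x = g x"
    using assms by (cases "x \<in> kd_ball") (auto simp: kd_functions_def kd_ball_def)
qed

section \<open>The metric and completeness\<close>

lemma poly_hardy_Metric_space: "Metric_space (poly_hardy Y) (poly_hardy_dist Y)"
proof
  fix f g
  show "0 \<le> poly_hardy_dist Y f g"
    by (simp add: poly_hardy_dist_def poly_hardy_norm_nonneg)
  show "poly_hardy_dist Y f g = poly_hardy_dist Y g f"
    unfolding poly_hardy_dist_def by (rule poly_hardy_norm_minus_commute)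
next
  fix f g assume f: "f \<in> poly_hardy Y" and g: "g \<in> poly_hardy Y"
  obtain c where c: "square_summable_coeffs TYPE('n) c" "power_expansion Y c f"
    using f by (auto simp: poly_hardy_iff)
  obtain c' where c': "square_summable_coeffs TYPE('n) c'" "power_expansion Y c' g"
    using g by (auto simp: poly_hardy_iff)
  show "poly_hardy_dist Y f g = 0 \<longleftrightarrow> f = g"
  proof
    assume "f = g"
    then show "poly_hardy_dist Y f g = 0"
      using poly_hardy_dist_eq[OF c, of c] c by (simp add: l2_norm_on_def)
  next
    assume "poly_hardy_dist Y f g = 0"
    \<comment> \<open>Each coefficient of the difference is bounded by the l2 norm, which is
      0.\<close>
    then have "c k l j = c' k l j" if "l \<in> {1..harmonic_dim TYPE('n) k}" for k l j
      using norm_le_l2_norm_on[OF l2_on_diff(1)[OF c(1)[unfolded square_summable_coeffs_iff]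
            c'(1)[unfolded square_summable_coeffs_iff]], of "(k, l, j)"] that
      by (simp add: poly_hardy_dist_eq[OF c c'])
    then have "expansion_sum c z \<theta> = expansion_sum c' z \<theta>" for z \<theta>
      unfolding expansion_sum_def by (intro infsum_cong) auto
    then show "f = g"
      using f g power_expansion_eq_expansion_sum[OF c] power_expansion_eq_expansion_sum[OF c']
      by (intro kd_functions_eqI) (auto simp: poly_hardy_iff)
  qed
next
  fix f g h assume f: "f \<in> poly_hardy Y" and g: "g \<in> poly_hardy Y" and h: "h \<in> poly_hardy Y"
  obtain c where c: "square_summable_coeffs TYPE('n) c" "power_expansion Y c f"
    using f by (auto simp: poly_hardy_iff)
  obtain c' where c': "square_summable_coeffs TYPE('n) c'" "power_expansion Y c' g"
    using g by (auto simp: poly_hardy_iff)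
  obtain c'' where c'': "square_summable_coeffs TYPE('n) c''" "power_expansion Y c'' h"
    using h by (auto simp: poly_hardy_iff)
  note sq = c(1)[unfolded square_summable_coeffs_iff] c'(1)[unfolded square_summable_coeffs_iff]
    c''(1)[unfolded square_summable_coeffs_iff]
  \<comment> \<open>\<open>l2_on_diff\<close> is applied to c - c' and c'' - c', whose difference is
    c - c''; the second norm must be flipped to match the distance from \<open>g\<close> to
    \<open>h\<close>.\<close>
  have "l2_norm_on (\<lambda>p. coeff_family c'' p - coeff_family c' p) (coeff_index TYPE('n)) =
      l2_norm_on (\<lambda>p. coeff_family c' p - coeff_family c'' p) (coeff_index TYPE('n))"
    by (rule l2_norm_on_cong) (rule norm_minus_commute)
  then show "poly_hardy_dist Y f h \<le> poly_hardy_dist Y f g + poly_hardy_dist Y g h"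
    using l2_on_diff(2)[OF l2_on_diff(1)[OF sq(1) sq(2)] l2_on_diff(1)[OF sq(3) sq(2)]]
    by (simp add: poly_hardy_dist_eq[OF c c'] poly_hardy_dist_eq[OF c c''] poly_hardy_dist_eq[OF c' c''])
qed

text \<open>A Cauchy sequence is passed to its coefficients, l2 supplies a limit family, and
  \<open>synthesis\<close> turns that into the limit function.\<close>

lemma poly_hardy_mcomplete: "Metric_space.mcomplete (poly_hardy Y) (poly_hardy_dist Y)"
proof -
  interpret Metric_space "poly_hardy Y" "poly_hardy_dist Y" by (rule poly_hardy_Metric_space)
  show ?thesis
    unfolding mcomplete_def
  proof (intro allI impI)
    fix f assume f: "MCauchy f"
    then have mem: "f n \<in> poly_hardy Y" for n by (auto simp: MCauchy_def)
    then have "\<exists>c. square_summable_coeffs TYPE('n) c \<and> power_expansion Y c (f n)" for n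
      by (simp add: poly_hardy_iff)
    then obtain c where c: "\<And>n. square_summable_coeffs TYPE('n) (c n)" "\<And>n. power_expansion Y (c n) (f n)"
      by metis
    have Cau: "\<exists>M. \<forall>m\<ge>M. \<forall>n\<ge>M. l2_norm_on (\<lambda>p. coeff_family (c m) p - coeff_family (c n) p) (coeff_index TYPE('n)) < e"
      if "e > 0" for e
      using f that unfolding MCauchy_def by (simp add: poly_hardy_dist_eq[OF c c]) 
    obtain v where v: "l2_summable_on v (coeff_index TYPE('n))"
      "(\<lambda>n. l2_norm_on (\<lambda>p. coeff_family (c n) p - v p) (coeff_index TYPE('n))) \<longlonglongrightarrow> 0"
      by (rule l2_on_complete[of "\<lambda>n. coeff_family (c n)", OF c(1)[unfolded square_summable_coeffs_iff] Cau])
    define b where "b = (\<lambda>k l j. v (k, l, j))"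
    have b: "coeff_family b = v" by (auto simp: coeff_family_def b_def)
    have sb: "square_summable_coeffs TYPE('n) b" using v by (simp add: square_summable_coeffs_iff b)
    have "synthesis b \<in> poly_hardy Y"
      using synthesis_power_expansion[OF sb] synthesis_kd_functions sb by (auto simp: poly_hardy_iff)
    moreover have "(\<lambda>n. poly_hardy_dist Y (f n) (synthesis b)) \<longlonglongrightarrow> 0"
      using v(2) by (simp add: poly_hardy_dist_eq[OF c sb synthesis_power_expansion[OF sb]] b)
    ultimately show "\<exists>x. limitin mtopology f x sequentially"
      using mem by (auto simp: limitin_metric_dist_null intro!: exI[of _ "synthesis b"])
  qed
qed

section \<open>Approximation by polyharmonic polynomials\<close>

text \<open>Truncate to k, j < N. The bound on j lets N Laplacians annihilate every term, the bound
  on k makes the index set finite, and these sets exhaust all indices, so the truncations converge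
  in l2.\<close>

lemma poly_hardy_polynomial_approximation:
  assumes f: "f \<in> poly_hardy Y"
  shows "\<exists>P Q. (\<forall>N. polynomial_function (P N) \<and>
             (\<forall>x\<in>ball 0 1. (laplacian ^^ N) (P N) x = 0) \<and>
             r_complexification Y (P N) (Q N) \<and> Q N \<in> poly_hardy Y) \<and>
        (\<lambda>N. poly_hardy_norm Y (Q N - f)) \<longlonglongrightarrow> 0"
proof -
  obtain c where c: "square_summable_coeffs TYPE('n) c" "power_expansion Y c f"
    using f by (auto simp: poly_hardy_iff)
  define A where "A N = (SIGMA k:{..<N}. {1..harmonic_dim TYPE('n) k} \<times> {..<N})" for N
  have A: "finite (A N)" "A N \<subseteq> coeff_index TYPE('n)" for N
    by (auto simp: A_def)
  have filter_A: "filterlim A (finite_subsets_at_top (coeff_index TYPE('n))) sequentially"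
    unfolding filterlim_finite_subsets_at_top
  proof (intro allI impI, elim conjE)
    fix X assume X: "finite X" "X \<subseteq> coeff_index TYPE('n)"
    \<comment> \<open>Exceeds every k and j occurring in \<open>X\<close>; a sum in place of a
      maximum also covers the empty set.\<close>
    define M where "M = Suc (\<Sum>(k, l, j)\<in>X. k + j)"
    have "X \<subseteq> A N" if "N \<ge> M" for N
    proof
      fix p assume "p \<in> X"
      obtain k l j where p: "p = (k, l, j)" by (cases p)
      have "k + j \<le> (\<Sum>(k, l, j)\<in>X. k + j)"
        using member_le_sum[of p X "\<lambda>(k, l, j). k + j"] X \<open>p \<in> X\<close> by (auto simp: p)
      then show "p \<in> A N" using that X \<open>p \<in> X\<close> by (auto simp: p A_def M_def)
    qed
    then show "\<forall>\<^sub>F N in sequentially. finite (A N) \<and> X \<subseteq> A N \<and> A N \<subseteq> coeff_index TYPE('n)"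
      using A by (auto simp: eventually_sequentially)
  qed
  define b where "b N k l j = (if (k, l, j) \<in> A N then c k l j else 0)" for N k l j
  have fam: "coeff_family (b N) = (\<lambda>p. if p \<in> A N then coeff_family c p else 0)" for N
    by (auto simp: coeff_family_def b_def)
  note trunc = l2_on_truncation[OF c(1)[unfolded square_summable_coeffs_iff] filter_A A, folded fam]
  have sb: "square_summable_coeffs TYPE('n) (b N)" for N
    using trunc(1) by (simp add: square_summable_coeffs_iff)
  \<comment> \<open>The factor |x|^(2j) replaces r^(2j), which makes r^(k+2j)
    \<open>Y k l \<theta>\<close> a polynomial in x.\<close>
  define P where "P N x = (\<Sum>p\<in>A N. coeff_family c p * (case p of (k, l, j) \<Rightarrow> norm_sq x ^ j * Y k l x))" for N x
  define Q where "Q N = synthesis (b N)" for N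
  have pol: "polynomial_function (\<lambda>x. case p of (k, l, j) \<Rightarrow> norm_sq x ^ j * Y k l x)" if "p \<in> A N" for p N
    using that A(2)[of N] by (cases p) (auto intro!: polynomial_function_norm_sq_power_times harmonicsD(1)[OF Y_harmonics])
  have "polynomial_function (P N)" for N
    unfolding P_def by (intro polynomial_function_sum_times A pol)
  moreover have "(laplacian ^^ N) (P N) x = 0" for N x
  proof -
    have "(laplacian ^^ N) (\<lambda>x. case p of (k, l, j) \<Rightarrow> norm_sq x ^ j * Y k l x) x = 0" if p: "p \<in> A N" for p
    proof -
      obtain k l j where klj: "p = (k, l, j)" by (cases p)
      then have "Y k l \<in> harmonics k" "j < N" using p by (auto simp: A_def intro!: Y_harmonics)
      then show ?thesis
        using laplacian_funpow_norm_sq_power[of "Y k l" k N j] by (auto simp: klj)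
    qed
    then show ?thesis
      unfolding P_def
      using laplacian_funpow_sum[of "A N" "\<lambda>p x. case p of (k, l, j) \<Rightarrow> norm_sq x ^ j * Y k l x" N "coeff_family c"] A pol
      by simp
  qed
  moreover have "r_complexification Y (P N) (Q N)" for N
    unfolding r_complexification_def
  proof (intro conjI exI[of _ c] exI[of _ "A N"] allI impI ballI)
    show "Q N \<in> kd_functions" unfolding Q_def by (rule synthesis_kd_functions)
    show "finite (A N)" by (rule A)
    show "A N \<subseteq> {(k, l, j). l \<in> {1..harmonic_dim TYPE('n) k}}" by (auto simp: A_def)
  next
    fix r :: real and \<theta> :: "real^'n" assume "r \<ge> 0" "\<theta> \<in> sphere 0 1"
    then have "norm_sq \<theta> = 1" by (simp add: norm_sq_def)
    then show "P N (r *\<^sub>R \<theta>) = (\<Sum>(k, l, j)\<in>A N. c k l j * of_real r ^ (k + 2 * j) * Y k l \<theta>)"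
      unfolding P_def
      by (intro sum.cong refl) (auto simp: A_def norm_sq_scaleR Y_scaleR power_add power_mult)
  next
    fix z \<theta> assume z: "z \<in> ball (0::complex) 1" and \<theta>: "\<theta> \<in> sphere (0::real^'n) 1"
    have "Q N (kd_point z \<theta>) = infsum (\<lambda>(k, l, j). c k l j * z ^ (k + 2 * j) * Y k l \<theta>) (A N)"
      unfolding Q_def synthesis_kd_point[OF z \<theta>] expansion_sum_def
      using A(2)[of N] by (intro infsum_cong_neutral) (auto simp: b_def)
    then show "Q N (kd_point z \<theta>) = (\<Sum>(k, l, j)\<in>A N. c k l j * z ^ (k + 2 * j) * Y k l \<theta>)"
      using A by simp
  qed
  moreover have "Q N \<in> poly_hardy Y" for N
    using synthesis_power_expansion[OF sb] synthesis_kd_functions sb by (auto simp: poly_hardy_iff Q_def)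
  moreover have "(\<lambda>N. poly_hardy_norm Y (Q N - f)) \<longlonglongrightarrow> 0"
  proof -
    have "poly_hardy_norm Y (Q N - f) = l2_norm_on (\<lambda>p. coeff_family (b N) p - coeff_family c p) (coeff_index TYPE('n))" for N
      using poly_hardy_dist_eq[OF sb synthesis_power_expansion[OF sb] c] by (simp add: Q_def poly_hardy_dist_def)
    then show ?thesis using trunc(2) by (simp add: fam)
  qed
  ultimately show ?thesis by (intro exI[of _ P] exI[of _ Q]) blast
qed

text \<open>The limits \<open>L k l\<close> are the sums of |c_klj|^2 over j, by
  \<open>hardy_parity_norm\<close>.\<close>

lemma poly_hardy_norm_coeffs:
  assumes c: "square_summable_coeffs TYPE('n) c" "power_expansion Y c f"
  shows "(poly_hardy_norm Y f)\<^sup>2 = (\<Sum>k. \<Sum>l = 1..harmonic_dim TYPE('n) k. \<Sum>j. (cmod (c k l j))\<^sup>2)"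
    and "\<exists>L. (\<forall>k. \<forall>l\<in>{1..harmonic_dim TYPE('n) k}.
                ((\<lambda>r. circle_mean (\<lambda>z. z ^ k * (\<Sum>j. c k l j * z ^ (2 * j))) r)
                   \<longlongrightarrow> L k l) (at_left 1)) \<and>
             (\<lambda>k. \<Sum>l = 1..harmonic_dim TYPE('n) k. L k l) sums (poly_hardy_norm Y f)\<^sup>2"
proof -
  have sums: "(\<lambda>k. \<Sum>l = 1..harmonic_dim TYPE('n) k. \<Sum>j. (cmod (c k l j))\<^sup>2) sums (poly_hardy_norm Y f)\<^sup>2"
    unfolding poly_hardy_norm_eq[OF c] by (rule square_summable_coeffs_sums[OF c(1)])
  then show "(poly_hardy_norm Y f)\<^sup>2 = (\<Sum>k. \<Sum>l = 1..harmonic_dim TYPE('n) k. \<Sum>j. (cmod (c k l j))\<^sup>2)"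
    by (rule sums_unique)
  have "((\<lambda>r. circle_mean (\<lambda>z. z ^ k * (\<Sum>j. c k l j * z ^ (2 * j))) r)
      \<longlongrightarrow> (\<Sum>j. (cmod (c k l j))\<^sup>2)) (at_left 1)" if "l \<in> {1..harmonic_dim TYPE('n) k}" for k l
    by (rule hardy_parity_norm(2)) (use parity_series_sums square_summable_coeffs_summable[OF c(1) that] in auto)
  then show "\<exists>L. (\<forall>k. \<forall>l\<in>{1..harmonic_dim TYPE('n) k}.
                ((\<lambda>r. circle_mean (\<lambda>z. z ^ k * (\<Sum>j. c k l j * z ^ (2 * j))) r)
                   \<longlongrightarrow> L k l) (at_left 1)) \<and>
             (\<lambda>k. \<Sum>l = 1..harmonic_dim TYPE('n) k. L k l) sums (poly_hardy_norm Y f)\<^sup>2"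
    using sums by (intro exI[of _ "\<lambda>k l. \<Sum>j. (cmod (c k l j))\<^sup>2"]) blast
qed

end

theorem theorem14:
  fixes \<sigma> :: "(real^'n) measure"
    and Y :: "nat \<Rightarrow> nat \<Rightarrow> real^'n \<Rightarrow> complex"
  assumes "CARD('n) \<ge> 2"
    and "rotation_invariant_sphere_measure \<sigma>"
    and "spherical_harmonic_basis \<sigma> Y"
  shows
    "(Metric_space (poly_hardy Y) (poly_hardy_dist Y) \<and>
      Metric_space.mcomplete (poly_hardy Y) (poly_hardy_dist Y)) \<and>
     poly_hardy Y =
       {f \<in> kd_functions. \<exists>c. square_summable_coeffs TYPE('n) c \<and> power_expansion Y c f} \<and>
     (\<forall>f\<in>poly_hardy Y. \<forall>c. square_summable_coeffs TYPE('n) c \<and> power_expansion Y c f \<longrightarrow>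
        poly_hardy_norm Y f =
          sqrt (\<Sum>k. \<Sum>l = 1..harmonic_dim TYPE('n) k. \<Sum>j. (cmod (c k l j))\<^sup>2) \<and>
        (\<exists>L. (\<forall>k. \<forall>l\<in>{1..harmonic_dim TYPE('n) k}.
                ((\<lambda>r. circle_mean (\<lambda>z. z ^ k * (\<Sum>j. c k l j * z ^ (2 * j))) r)
                   \<longlongrightarrow> L k l) (at_left 1)) \<and>
             (\<lambda>k. \<Sum>l = 1..harmonic_dim TYPE('n) k. L k l) sums (poly_hardy_norm Y f)\<^sup>2) \<and>
        (poly_hardy_norm Y f)\<^sup>2 =
          (\<Sum>k. \<Sum>l = 1..harmonic_dim TYPE('n) k. \<Sum>j. (cmod (c k l j))\<^sup>2)) \<and>
     (\<forall>f\<in>poly_hardy Y. \<exists>P Q.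
        (\<forall>N. polynomial_function (P N) \<and>
             (\<forall>x\<in>ball 0 1. (laplacian ^^ N) (P N) x = 0) \<and>
             r_complexification Y (P N) (Q N) \<and> Q N \<in> poly_hardy Y) \<and>
        (\<lambda>N. poly_hardy_norm Y (Q N - f)) \<longlonglongrightarrow> 0)"
proof -
  interpret spherical_basis \<sigma> Y using assms by unfold_locales
  \<comment> \<open>The square is known from \<open>poly_hardy_norm_coeffs\<close>; nonnegativity of
    the norm selects the root.\<close>
  have norm: "poly_hardy_norm Y f = sqrt (\<Sum>k. \<Sum>l = 1..harmonic_dim TYPE('n) k. \<Sum>j. (cmod (c k l j))\<^sup>2)"
    if "square_summable_coeffs TYPE('n) c" "power_expansion Y c f" for c f
    using poly_hardy_norm_coeffs(1)[OF that] poly_hardy_norm_nonneg[of f]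
    by (metis real_sqrt_unique)
  show ?thesis
    using poly_hardy_Metric_space poly_hardy_mcomplete poly_hardy_iff norm
      poly_hardy_norm_coeffs poly_hardy_polynomial_approximation
    by (intro conjI ballI allI impI) (blast | elim conjE, assumption?)+
qed

end
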